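(* Let $\mathcal X,\mathcal Y,a,\ell$ satisfy the main assumptions stated in the context. (1) Suppose $B:=\sup_{y,y',y''\in\mathcal Y}[\ell(y,y')-\ell(y,y'')]<+\infty$. Then for every finite nonempty set $\mathcal G$ of prediction functions, every $n\ge1$ and every distribution $P$, any empirical risk minimizer, i.e. any algorithm producing a prediction function $\hat g_{\mathrm{erm}}\in\operatorname{argmin}_{g\in\mathcal G}\Sigma_n(g)$, where $\Sigma_n(g)=\sum_{j=1}^n\ell[Y_j,g(X_j)]$, satisfies $$\mathbb E R(\hat g_{\mathrm{erm}})\le\min_{g\in\mathcal G}R(g)+B\sqrt{\frac{2\log|\mathcal G|}{n}}.$$ (2) Let $y_1,\tilde y_1\in\mathcal Y\cap(a,+\infty)$ and let $d$ be a positive integer. There exists a set $\mathcal G$ of $d$ prediction functions such that for any training set size $n\ge1$ and any learning algorithm producing a prediction function $\hat g$ that belongs to $\mathcal G$ (e.g. $\hat g_{\mathrm{erm}}$), there exists a probability distribution $P$ generating the data for which - the output marginal is supported by $2a-y_1$ and $y_1$: $P(Y\in\{2a-y_1,\,y_1\})=1$; - $$\mathbb E R(\hat g)\ge\min_{g\in\mathcal G}R(g)+\frac{\delta}{8}\left(\sqrt{\frac{\lfloor\log_2|\mathcal G|\rfloor}{n}}\wedge2\right),\qquad\text{with }\ \delta:=\ell(y_1,2a-\tilde y_1)-\ell(y_1,\tilde y_1)>0 .$$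
   Context: Setup. One observes a training set $Z_1=(X_1,Y_1),\dots,Z_n=(X_n,Y_n)$ of i.i.d. pairs drawn from a distribution $P$ on $\mathcal Z=\mathcal X\times\mathcal Y$. A prediction function is a map $g:\mathcal X\to\mathcal Y$; its risk is $R(g)=\mathbb E_{(X,Y)\sim P}\,\ell[Y,g(X)]$, where $\ell:\mathcal Y\times\mathcal Y\to\mathbb R\cup\{+\infty\}$ is the loss function. A learning algorithm maps each training set to a prediction function $\hat g$; $\mathbb E R(\hat g)$ is the expectation over the training set. Notation: $u\wedge v=\min(u,v)$, $\log_2$ is the base-2 logarithm, $\lfloor x\rfloor$ is the largest integer $\le x$. Main assumptions. $\mathcal X$ is infinite. $\mathcal Y$ is an infinite interval of $\mathbb R$ symmetrical with respect to some $a\in\mathbb R$: $y\in\mathcal Y\Rightarrow 2a-y\in\mathcal Y$. The loss is: - uniformly exp-concave: there exists $\lambda>0$ such that for any $y\in\mathcal Y$ the set $\{y'\in\mathcal Y:\ell(y,y')<+\infty\}$ is an interval containing $a$ on which $y'\mapsto e^{-\lambda\ell(y,y')}$ is concave; - symmetrical: $\ell(u,v)=\ell(2a-u,2a-v)$ for all $u,v\in\mathcal Y$; - admissible: $\ell(y,2a-y')>\ell(y,y')$ for all $y,y'\in\mathcal Y\cap(a,+\infty)$; - well behaved at center: for any $y\in\mathcal Y\cap(a,+\infty)$, the function $\ell_y:y'\mapsto\ell(y,y')$ is twice continuously differentiable on a neighborhood of $a$ and $\ell_y'(a)<0$. *)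

theory Defs
  imports "HOL-Probability.Probability"
begin

text \<open>
  The input space is the whole type \<open>'x\<close>. Of the measure \<open>MX\<close> only the sigma-algebra matters.
  The output space \<open>Y\<close> is a subset of the reals with its trace Borel sigma-algebra; only the
  values of a loss \<open>l\<close> on \<open>Y \<times> Y\<close> are relevant.
\<close>

definition output_space :: "real set \<Rightarrow> real measure" where
  "output_space Y = restrict_space borel Y"

definition data_space :: "'x measure \<Rightarrow> real set \<Rightarrow> ('x \<times> real) measure" where
  "data_space MX Y = MX \<Otimes>\<^sub>M output_space Y"

definition data_distribution ::
    "'x measure \<Rightarrow> real set \<Rightarrow> ('x \<times> real) measure \<Rightarrow> bool" where
  "data_distribution MX Y P \<longleftrightarrow> prob_space P \<and> sets P = sets (data_space MX Y)"

abbreviation prediction_functions :: "'x measure \<Rightarrow> real set \<Rightarrow> ('x \<Rightarrow> real) set" where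
  "prediction_functions MX Y \<equiv> MX \<rightarrow>\<^sub>M output_space Y"

subsection \<open>Assumptions on the loss\<close>

definition unif_exp_concave :: "real set \<Rightarrow> real \<Rightarrow> (real \<Rightarrow> real \<Rightarrow> ereal) \<Rightarrow> bool" where
  "unif_exp_concave Y a l \<longleftrightarrow>
    (\<exists>lam>0. \<forall>y\<in>Y.
      is_interval {y'\<in>Y. l y y' < \<infinity>} \<and> a \<in> {y'\<in>Y. l y y' < \<infinity>} \<and>
      concave_on {y'\<in>Y. l y y' < \<infinity>} (\<lambda>y'. exp (- lam * real_of_ereal (l y y'))))"

definition symmetrical_loss :: "real set \<Rightarrow> real \<Rightarrow> (real \<Rightarrow> real \<Rightarrow> ereal) \<Rightarrow> bool" where
  "symmetrical_loss Y a l \<longleftrightarrow> (\<forall>u\<in>Y. \<forall>v\<in>Y. l u v = l (2 * a - u) (2 * a - v))"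

definition admissible_loss :: "real set \<Rightarrow> real \<Rightarrow> (real \<Rightarrow> real \<Rightarrow> ereal) \<Rightarrow> bool" where
  "admissible_loss Y a l \<longleftrightarrow>
    (\<forall>y\<in>Y \<inter> {a<..}. \<forall>y'\<in>Y \<inter> {a<..}. l y (2 * a - y') > l y y')"

text \<open>On an open set, \<open>f\<close> is twice continuously differentiable iff it is differentiable with
  a derivative of class C1.\<close>

definition well_behaved_at_center :: "real set \<Rightarrow> real \<Rightarrow> (real \<Rightarrow> real \<Rightarrow> ereal) \<Rightarrow> bool" where
  "well_behaved_at_center Y a l \<longleftrightarrow>
    (\<forall>y\<in>Y \<inter> {a<..}. \<exists>U. open U \<and> a \<in> U \<and> U \<subseteq> Y \<and> (\<forall>y'\<in>U. l y y' < \<infinity>) \<and>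
      (let f = (\<lambda>y'. real_of_ereal (l y y')) in
        f differentiable_on U \<and> deriv f C1_differentiable_on U \<and> deriv f a < 0))"

text \<open>
  The inputs form an infinite set carrying an infinite sigma-algebra. The second requirement
  makes the infinitely many inputs visible to measurable prediction functions (on a trivial
  sigma-algebra all of these are constant); it follows from the first one if singletons are
  measurable. The interval \<open>Y\<close> is infinite as a set, and may be bounded.
\<close>

locale main_assumptions =
  fixes MX :: "'x measure" and Y :: "real set" and a :: real
    and l :: "real \<Rightarrow> real \<Rightarrow> ereal"
  assumes space_MX: "space MX = UNIV"
    and infinite_X: "infinite (UNIV :: 'x set)"
    and infinite_sets_MX: "infinite (sets MX)"
    and interval_Y: "is_interval Y"
    and infinite_Y: "infinite Y"
    and symmetric_Y: "\<And>y. y \<in> Y \<Longrightarrow> 2 * a - y \<in> Y"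
    and loss_not_minf: "\<And>y y'. y \<in> Y \<Longrightarrow> y' \<in> Y \<Longrightarrow> l y y' \<noteq> -\<infinity>"
    and loss_measurable:
      "(\<lambda>(y, y'). l y y') \<in> borel_measurable (output_space Y \<Otimes>\<^sub>M output_space Y)"
    and exp_concave: "unif_exp_concave Y a l"
    and symmetrical: "symmetrical_loss Y a l"
    and admissible: "admissible_loss Y a l"
    and well_behaved: "well_behaved_at_center Y a l"

subsection \<open>Expectations, risks and learning algorithms\<close>

text \<open>
  Expectation of an extended real function: positive part minus negative part. It is
  meaningful if at least one of them is finite; otherwise it evaluates to \<open>\<infinity>\<close>, because
  \<open>\<infinity> - \<infinity> = \<infinity>\<close> in type \<open>ereal\<close>. Note that \<open>e2ennreal\<close> sends negative numbers to 0.
\<close>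

definition ereal_expectation :: "'b measure \<Rightarrow> ('b \<Rightarrow> ereal) \<Rightarrow> ereal" where
  "ereal_expectation M f =
    enn2ereal (\<integral>\<^sup>+w. e2ennreal (f w) \<partial>M) - enn2ereal (\<integral>\<^sup>+w. e2ennreal (- f w) \<partial>M)"

definition has_ereal_expectation :: "'b measure \<Rightarrow> ('b \<Rightarrow> ereal) \<Rightarrow> bool" where
  "has_ereal_expectation M f \<longleftrightarrow> f \<in> borel_measurable M \<and>
    ((\<integral>\<^sup>+w. e2ennreal (f w) \<partial>M) < \<infinity> \<or> (\<integral>\<^sup>+w. e2ennreal (- f w) \<partial>M) < \<infinity>)"

definition pred_loss :: "(real \<Rightarrow> real \<Rightarrow> ereal) \<Rightarrow> ('x \<Rightarrow> real) \<Rightarrow> 'x \<times> real \<Rightarrow> ereal" where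
  "pred_loss l g z = l (snd z) (g (fst z))"

definition risk ::
    "(real \<Rightarrow> real \<Rightarrow> ereal) \<Rightarrow> ('x \<times> real) measure \<Rightarrow> ('x \<Rightarrow> real) \<Rightarrow> ereal" where
  "risk l P g = ereal_expectation P (pred_loss l g)"

text \<open>A training set of size \<open>n\<close> is an element of the \<open>n\<close>-fold product, indexed from 0.\<close>

definition training_space ::
    "nat \<Rightarrow> ('x \<times> real) measure \<Rightarrow> (nat \<Rightarrow> 'x \<times> real) measure" where
  "training_space n P = (\<Pi>\<^sub>M j\<in>{..<n}. P)"

definition emp_risk ::
    "(real \<Rightarrow> real \<Rightarrow> ereal) \<Rightarrow> nat \<Rightarrow> (nat \<Rightarrow> 'x \<times> real) \<Rightarrow> ('x \<Rightarrow> real) \<Rightarrow> ereal" where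
  "emp_risk l n z g = (\<Sum>j<n. l (snd (z j)) (g (fst (z j))))"

text \<open>Joint measurability in the training set and the new input makes the risk of the output
  of the algorithm a random variable.\<close>

definition learning_algorithm ::
    "'x measure \<Rightarrow> real set \<Rightarrow> nat \<Rightarrow> ((nat \<Rightarrow> 'x \<times> real) \<Rightarrow> 'x \<Rightarrow> real) \<Rightarrow> bool" where
  "learning_algorithm MX Y n alg \<longleftrightarrow>
    (\<lambda>(z, x). alg z x) \<in> training_space n (data_space MX Y) \<Otimes>\<^sub>M MX \<rightarrow>\<^sub>M output_space Y"

definition empirical_risk_minimizer ::
    "'x measure \<Rightarrow> real set \<Rightarrow> (real \<Rightarrow> real \<Rightarrow> ereal) \<Rightarrow> ('x \<Rightarrow> real) set \<Rightarrow> nat \<Rightarrow>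
      ((nat \<Rightarrow> 'x \<times> real) \<Rightarrow> 'x \<Rightarrow> real) \<Rightarrow> bool" where
  "empirical_risk_minimizer MX Y l G n alg \<longleftrightarrow> learning_algorithm MX Y n alg \<and>
    (\<forall>z\<in>space (training_space n (data_space MX Y)).
      is_arg_min (emp_risk l n z) (\<lambda>g. g \<in> G) (alg z))"

definition expected_risk ::
    "(real \<Rightarrow> real \<Rightarrow> ereal) \<Rightarrow> nat \<Rightarrow> ('x \<times> real) measure \<Rightarrow>
      ((nat \<Rightarrow> 'x \<times> real) \<Rightarrow> 'x \<Rightarrow> real) \<Rightarrow> ereal" where
  "expected_risk l n P alg = ereal_expectation (training_space n P) (\<lambda>z. risk l P (alg z))"

text \<open>All the expectations involved in comparing an algorithm with values in \<open>G\<close> to the best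
  element of \<open>G\<close> are meaningful (possibly infinite).\<close>

definition risks_exist ::
    "(real \<Rightarrow> real \<Rightarrow> ereal) \<Rightarrow> nat \<Rightarrow> ('x \<times> real) measure \<Rightarrow> ('x \<Rightarrow> real) set \<Rightarrow>
      ((nat \<Rightarrow> 'x \<times> real) \<Rightarrow> 'x \<Rightarrow> real) \<Rightarrow> bool" where
  "risks_exist l n P G alg \<longleftrightarrow> (\<forall>g\<in>G. has_ereal_expectation P (pred_loss l g)) \<and>
    has_ereal_expectation (training_space n P) (\<lambda>z. risk l P (alg z))"

text \<open>If \<open>l y y'\<close> is infinite for some \<open>y\<close>, \<open>y'\<close> in \<open>Y\<close>, then so is this supremum:
  take \<open>y'' = a\<close>, where \<open>l y\<close> is finite under the main assumptions.\<close>

definition loss_gap :: "real set \<Rightarrow> (real \<Rightarrow> real \<Rightarrow> ereal) \<Rightarrow> ereal" where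
  "loss_gap Y l = (SUP (y, y', y'') \<in> Y \<times> Y \<times> Y. l y y' - l y y'')"

end

theory Submission
  imports Defs
begin

text \<open>
  Upper bound: a minimizer exceeds the best risk by at most the maximum over \<open>g \<in> \<G>\<close> of the
  deviation of the empirical mean of \<open>\<ell>[Y, g(X)] - \<ell>[Y, g\<^sup>*(X)]\<close> from its expectation. These
  differences lie in \<open>[-B, B]\<close>, so Hoeffding's lemma makes each deviation subgaussian, and the
  maximum is bounded by the usual exponential moment argument. If the losses are not integrable,
  then the bounded differences force all risks to be the same infinite value.

  Lower bound: with \<open>m = \<lfloor>log\<^sub>2 d\<rfloor>\<close>, the class \<open>\<G>\<close> realises all \<open>2\<^sup>m\<close> sign patterns (value \<open>yt1\<close> or
  its reflection) on \<open>m\<close> points. The input is uniform on these points, and at point \<open>i\<close> the label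
  is one of \<open>y1\<close>, \<open>2a - y1\<close> with probabilities \<open>(1 \<plusminus> \<xi>)/2\<close>, where
  \<open>\<xi> = min (sqrt (m/n)) 2 / 2\<close>. A wrong sign at one point costs \<open>\<delta> \<xi> / m\<close>, and by Assouad's
  argument some choice of the signs of the biases makes the algorithm
  wrong at no less than \<open>m/4\<close> points on average.
  For this, the overlap of two sample distributions \<open>p\<close>, \<open>q\<close> that differ at one point is bounded
  below through \<open>\<Sum> min p q \<ge> 2 (\<Sum> p q / (p + q)) - 1/4\<close>; the last sum shrinks at most by the
  factor \<open>1 - \<xi>\<^sup>2 / m\<close> per observation, so that \<open>\<Sum> min p q \<ge> 1/2\<close>. If \<open>\<delta>\<close>
  is infinite, an unbiased label makes all risks infinite.
\<close>

subsection \<open>The empirical risk minimizer\<close>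

lemma ereal_expectation_real:
  assumes "integrable M r" "\<And>w. w \<in> space M \<Longrightarrow> f w = ereal (r w)"
  shows "ereal_expectation M f = ereal (\<integral>w. r w \<partial>M)" "has_ereal_expectation M f"
proof -
  have [measurable]: "r \<in> borel_measurable M" using assms(1) by auto
  have pos: "(\<integral>\<^sup>+w. e2ennreal (f w) \<partial>M) = (\<integral>\<^sup>+w. ennreal (r w) \<partial>M)"
    using assms(2) by (intro nn_integral_cong) simp
  have neg: "(\<integral>\<^sup>+w. e2ennreal (- f w) \<partial>M) = (\<integral>\<^sup>+w. ennreal (- r w) \<partial>M)"
    using assms(2) by (intro nn_integral_cong) simp
  have fin: "(\<integral>\<^sup>+w. ennreal (r w) \<partial>M) < \<infinity>" "(\<integral>\<^sup>+w. ennreal (- r w) \<partial>M) < \<infinity>"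
    using assms(1) by (auto simp: real_integrable_def top.not_eq_extremum)
  have real: "enn2ereal x = ereal (enn2real x)" if "x < \<infinity>" for x
    using that by (cases x) auto
  show "ereal_expectation M f = ereal (\<integral>w. r w \<partial>M)"
    unfolding ereal_expectation_def pos neg real_lebesgue_integral_def[OF assms(1)]
      real[OF fin(1)] real[OF fin(2)] by simp
  have "f \<in> borel_measurable M \<longleftrightarrow> (\<lambda>w. ereal (r w)) \<in> borel_measurable M"
    using assms(2) by (intro measurable_cong)
  then show "has_ereal_expectation M f"
    unfolding has_ereal_expectation_def pos neg using fin by simp
qed

text \<open>Independence splits the exponential into \<open>n\<close> identical factors. Hoeffding's
  lemma with parameter \<open>s / n\<close>, on a range of length \<open>2 * B\<close>, bounds each
  by \<open>exp ((s / n)^2 * (2 * B)^2 / 8)\<close>. With the nonnegative integral, integrability is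
  a consequence of the bound rather than a premise.\<close>

lemma nn_integral_exp_mean_deviation_le:
  fixes W :: "'z \<Rightarrow> real"
  assumes P: "prob_space P" and W [measurable]: "W \<in> borel_measurable P"
    and bound: "\<And>z. z \<in> space P \<Longrightarrow> \<bar>W z\<bar> \<le> B" and s: "s > 0" and n: "n \<ge> 1"
  shows "(\<integral>\<^sup>+z. ennreal (exp (s * ((\<integral>w. W w \<partial>P) - (\<Sum>j<n. W (z j)) / real n))) \<partial>(\<Pi>\<^sub>M j\<in>{..<n}. P))
    \<le> ennreal (exp (s\<^sup>2 * B\<^sup>2 / (2 * real n)))"
proof -
  interpret P: prob_space P by fact
  \<comment> \<open>The sign is reversed because the deviation is expectation minus empirical
    mean.\<close>
  interpret V: interval_bounded_random_variable P "\<lambda>z. - W z" "- B" B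
    by unfold_locales (use bound in \<open>auto intro!: AE_I2 simp: abs_le_iff\<close>)
  interpret prod: product_sigma_finite "\<lambda>_::nat. P" by unfold_locales
  define \<phi> where "\<phi> w = exp ((s / real n) * (- W w - (\<integral>w. - W w \<partial>P)))" for w
  have [measurable]: "\<phi> \<in> borel_measurable P" unfolding \<phi>_def by measurable
  have "exp (s * ((\<integral>w. W w \<partial>P) - (\<Sum>j<n. W (z j)) / real n)) = (\<Prod>j<n. \<phi> (z j))" for z
  proof -
    have "(\<Prod>j<n. \<phi> (z j)) = exp (\<Sum>j<n. (s / real n) * (- W (z j) - (\<integral>w. - W w \<partial>P)))"
      unfolding \<phi>_def by (simp only: exp_sum finite_lessThan)
    also have "(\<Sum>j<n. (s / real n) * (- W (z j) - (\<integral>w. - W w \<partial>P)))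
        = (s / real n) * (real n * (\<integral>w. W w \<partial>P) - (\<Sum>j<n. W (z j)))"
      by (simp add: sum_subtractf right_diff_distrib sum_distrib_left sum_divide_distrib)
    also have "\<dots> = s * ((\<integral>w. W w \<partial>P) - (\<Sum>j<n. W (z j)) / real n)"
      using n by (simp add: field_simps)
    finally show ?thesis by simp
  qed
  then have "(\<integral>\<^sup>+z. ennreal (exp (s * ((\<integral>w. W w \<partial>P) - (\<Sum>j<n. W (z j)) / real n))) \<partial>(\<Pi>\<^sub>M j\<in>{..<n}. P))
      = (\<integral>\<^sup>+z. (\<Prod>j<n. ennreal (\<phi> (z j))) \<partial>(\<Pi>\<^sub>M j\<in>{..<n}. P))"
    by (simp add: prod_ennreal \<phi>_def)
  also have "\<dots> = (\<Prod>j<n. \<integral>\<^sup>+w. ennreal (\<phi> w) \<partial>P)"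
    by (rule prod.product_nn_integral_prod) auto
  also have "\<dots> = (\<integral>\<^sup>+w. ennreal (\<phi> w) \<partial>P) ^ n" by simp
  also have "\<dots> \<le> ennreal (exp ((s / real n)\<^sup>2 * (B - (- B))\<^sup>2 / 8)) ^ n"
    unfolding \<phi>_def using s n by (intro power_mono V.Hoeffdings_lemma_nn_integral) auto
  also have "\<dots> = ennreal (exp (real n * ((s / real n)\<^sup>2 * (B - (- B))\<^sup>2 / 8)))"
    by (simp only: ennreal_power exp_of_nat_mult exp_ge_zero)
  also have "real n * ((s / real n)\<^sup>2 * (B - (- B))\<^sup>2 / 8) = s\<^sup>2 * B\<^sup>2 / (2 * real n)"
    using n by (simp add: field_simps power2_eq_square)
  finally show ?thesis .
qed

text \<open>Bounding the maximum of the deviations through the convex dual form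
  \<open>x \<le> ln c + exp x / c - 1\<close> of the logarithm avoids Jensen's inequality.\<close>

lemma integral_max_deviation_le:
  fixes W :: "'g \<Rightarrow> 'z \<Rightarrow> real" and U :: "(nat \<Rightarrow> 'z) \<Rightarrow> real"
  assumes P: "prob_space P" and G: "finite G" "G \<noteq> {}"
    and W [measurable]: "\<And>g. g \<in> G \<Longrightarrow> W g \<in> borel_measurable P"
    and bound: "\<And>g z. g \<in> G \<Longrightarrow> z \<in> space P \<Longrightarrow> \<bar>W g z\<bar> \<le> B" and s: "s > 0" and n: "n \<ge> 1"
    and U: "integrable (\<Pi>\<^sub>M j\<in>{..<n}. P) U"
    and le: "\<And>z. z \<in> space (\<Pi>\<^sub>M j\<in>{..<n}. P) \<Longrightarrow>
      \<exists>g\<in>G. U z \<le> (\<integral>w. W g w \<partial>P) - (\<Sum>j<n. W g (z j)) / real n"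
  shows "(\<integral>z. U z \<partial>(\<Pi>\<^sub>M j\<in>{..<n}. P)) \<le> ln (real (card G)) / s + s * (B\<^sup>2 / (2 * real n))"
proof -
  let ?T = "\<Pi>\<^sub>M j\<in>{..<n}. P"
  interpret T: prob_space ?T by (intro prob_space_PiM P)
  define e where "e g z = exp (s * ((\<integral>w. W g w \<partial>P) - (\<Sum>j<n. W g (z j)) / real n))" for g z
  have e_meas [measurable]: "e g \<in> borel_measurable ?T" if "g \<in> G" for g
    unfolding e_def using that by measurable
  define b where "b = exp (s\<^sup>2 * B\<^sup>2 / (2 * real n))"
  have e_bound: "(\<integral>\<^sup>+z. ennreal (e g z) \<partial>?T) \<le> ennreal b" if "g \<in> G" for g
    unfolding e_def b_def using that s n
    by (intro nn_integral_exp_mean_deviation_le P W bound)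
  have b: "b > 0" by (simp add: b_def)
  have e_int: "integrable ?T (e g)" if "g \<in> G" for g
  proof (rule integrableI_bounded)
    show "(\<integral>\<^sup>+z. ennreal (norm (e g z)) \<partial>?T) < \<infinity>"
      using e_bound[OF that] by (simp add: e_def order_le_less_trans)
  qed (use that in measurable)
  have e_le: "(\<integral>z. e g z \<partial>?T) \<le> b" if "g \<in> G" for g
    using e_bound[OF that] b by (intro integral_real_bounded) auto
  \<comment> \<open>The tangent to the logarithm is taken at \<open>c\<close>, a bound on the
    expectation of the sum of all \<open>e g\<close>. After integration the quotient is at most 1
    and cancels the \<open>- 1\<close>.\<close>
  define c where "c = real (card G) * b"
  have card: "card G > 0" using G by (simp add: card_gt_0_iff)
  then have c: "c > 0" using b by (simp add: c_def)
  have "s * U z \<le> ln c - 1 + (\<Sum>g\<in>G. e g z) / c" if z: "z \<in> space ?T" for z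
  proof -
    obtain g where g: "g \<in> G" "U z \<le> (\<integral>w. W g w \<partial>P) - (\<Sum>j<n. W g (z j)) / real n"
      using le[OF z] by auto
    have "exp (s * U z) \<le> e g z" unfolding e_def using g s by simp
    also have "\<dots> \<le> (\<Sum>g\<in>G. e g z)"
      using g G by (intro member_le_sum) (auto simp: e_def)
    finally have "exp (s * U z) / c \<le> (\<Sum>g\<in>G. e g z) / c" using c by (simp add: divide_right_mono)
    moreover have "ln (exp (s * U z) / c) \<le> exp (s * U z) / c - 1"
      using c by (intro ln_le_minus_one) simp
    moreover have "ln (exp (s * U z) / c) = s * U z - ln c" using c by (simp add: ln_div)
    ultimately show ?thesis by simp
  qed
  then have "(\<integral>z. s * U z \<partial>?T) \<le> (\<integral>z. ln c - 1 + (\<Sum>g\<in>G. e g z) / c \<partial>?T)"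
    using U e_int by (intro integral_mono) auto
  also have "\<dots> = ln c - 1 + (\<Sum>g\<in>G. \<integral>z. e g z \<partial>?T) / c"
    using e_int by (simp add: T.prob_space)
  also have "\<dots> \<le> ln c - 1 + (\<Sum>g\<in>G. b) / c"
    using c e_le by (intro add_left_mono divide_right_mono sum_mono) auto
  also have "\<dots> = ln c" using card b by (simp add: c_def)
  also have "\<dots> = ln (real (card G)) + s\<^sup>2 * B\<^sup>2 / (2 * real n)"
    using card b by (simp add: c_def ln_mult b_def)
  finally have "s * (\<integral>z. U z \<partial>?T) \<le> ln (real (card G)) + s\<^sup>2 * B\<^sup>2 / (2 * real n)" by simp
  then have "(\<integral>z. U z \<partial>?T) \<le> (ln (real (card G)) + s\<^sup>2 * B\<^sup>2 / (2 * real n)) / s"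
    using s by (simp add: pos_le_divide_eq mult.commute)
  also have "\<dots> = ln (real (card G)) / s + s * (B\<^sup>2 / (2 * real n))"
    using s by (simp add: add_divide_distrib power2_eq_square)
  finally show ?thesis .
qed

text \<open>For positive \<open>a\<close>, \<open>b\<close> the right side is smallest at
  \<open>s = sqrt (a / b)\<close>, where both terms equal \<open>sqrt (a * b)\<close>. If one of
  them is 0, the infimum 0 is approached as \<open>s\<close> tends to 0 or to infinity; this covers
  a class with one element and the case \<open>B = 0\<close>.\<close>

lemma le_sqrt_of_le_scaled:
  fixes x a b :: real
  assumes "a \<ge> 0" "b \<ge> 0" and le: "\<And>s. s > 0 \<Longrightarrow> x \<le> a / s + s * b"
  shows "x \<le> 2 * sqrt (a * b)"
proof (cases "a = 0 \<or> b = 0")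
  case True
  have "x \<le> 0"
  proof (rule ccontr)
    assume x: "\<not> x \<le> 0"
    show False
    proof (cases "a = 0")
      case True
      \<comment> \<open>This \<open>s\<close> is small enough for \<open>s * b < x\<close>; the
        \<open>+ 1\<close> avoids division by 0.\<close>
      have "x \<le> (x / (b + 1) / 2) * b"
        using le[of "x / (b + 1) / 2"] True x assms by simp
      also have "\<dots> < x"
        using x assms by (simp add: field_simps) (smt (verit) mult_nonneg_nonneg)
      finally show False by simp
    next
      case False
      with \<open>a = 0 \<or> b = 0\<close> have "x \<le> a / (2 * a / x)"
        using le[of "2 * a / x"] x assms by simp
      then show False using False x by simp
    qed
  qed
  with True show ?thesis by auto
next
  case False
  with assms have pos: "a > 0" "b > 0" by auto
  then have "x \<le> a / sqrt (a / b) + sqrt (a / b) * b" by (intro le) simp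
  also have "a / sqrt (a / b) = sqrt (a * b)"
    using pos by (simp add: real_sqrt_divide real_sqrt_mult field_simps)
  also have "sqrt (a / b) * b = sqrt (a * b)"
    using pos by (simp add: real_sqrt_divide real_sqrt_mult field_simps)
  finally show ?thesis by simp
qed

lemma training_space_cong:
  "data_distribution MX Y P \<Longrightarrow>
    sets (training_space n P) = sets (training_space n (data_space MX Y))"
  unfolding training_space_def data_distribution_def by (intro sets_PiM_cong) auto

section \<open>Measurability and finiteness of risks; the bound for the empirical risk
  minimizer\<close>

context main_assumptions
begin

lemma space_data_space: "space (data_space MX Y) = UNIV \<times> Y"
  by (simp add: data_space_def output_space_def space_pair_measure space_MX space_restrict_space)

lemma space_data_distribution: "data_distribution MX Y P \<Longrightarrow> space P = UNIV \<times> Y"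
  using sets_eq_imp_space_eq[of P "data_space MX Y"]
  by (simp add: data_distribution_def space_data_space)

lemma prediction_function_mem: "g \<in> prediction_functions MX Y \<Longrightarrow> g x \<in> Y"
  using measurable_space[of g MX "output_space Y" x]
  by (simp add: space_MX output_space_def space_restrict_space)

lemma measurable_pred_loss:
  assumes P: "data_distribution MX Y P" and g [measurable]: "g \<in> prediction_functions MX Y"
  shows "pred_loss l g \<in> borel_measurable P"
proof -
  have sets [measurable_cong]: "sets P = sets (MX \<Otimes>\<^sub>M output_space Y)"
    using P by (simp add: data_distribution_def data_space_def)
  have "(\<lambda>w. (snd w, g (fst w))) \<in> P \<rightarrow>\<^sub>M output_space Y \<Otimes>\<^sub>M output_space Y"
    by measurable
  from measurable_compose[OF this loss_measurable] show ?thesis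
    by (simp add: pred_loss_def[abs_def])
qed

text \<open>Integrating out the new observation preserves measurability in the training set
  (Tonelli), thanks to the joint measurability of the algorithm.\<close>

lemma measurable_risk:
  assumes P: "data_distribution MX Y P" and alg: "learning_algorithm MX Y n alg"
  shows "(\<lambda>z. risk l P (alg z)) \<in> borel_measurable (training_space n P)"
proof -
  interpret P: prob_space P using P by (simp add: data_distribution_def)
  have sets [measurable_cong]: "sets P = sets (MX \<Otimes>\<^sub>M output_space Y)"
    using P by (simp add: data_distribution_def data_space_def)
  have [measurable]: "(\<lambda>(z, x). alg z x) \<in> training_space n P \<Otimes>\<^sub>M MX \<rightarrow>\<^sub>M output_space Y"
    using alg unfolding learning_algorithm_def
    by (subst measurable_cong_sets[OF sets_pair_measure_cong[OF training_space_cong[OF P] refl] refl])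
  have "(\<lambda>(z, w). (snd w, (\<lambda>(z, x). alg z x) (z, fst w)))
      \<in> training_space n P \<Otimes>\<^sub>M P \<rightarrow>\<^sub>M output_space Y \<Otimes>\<^sub>M output_space Y"
    by measurable
  from measurable_compose[OF this loss_measurable]
  have [measurable]: "(\<lambda>(z, w). pred_loss l (alg z) w) \<in> borel_measurable (training_space n P \<Otimes>\<^sub>M P)"
    by (simp add: pred_loss_def case_prod_unfold)
  show ?thesis
    unfolding risk_def ereal_expectation_def by measurable
qed

text \<open>An algorithm with values in a finite class takes finitely many risks, so its risk is
  bounded, hence integrable.\<close>

lemma expected_risk_real:
  assumes P: "data_distribution MX Y P" and alg: "learning_algorithm MX Y n alg"
    and G: "finite G" "\<And>z. z \<in> space (training_space n P) \<Longrightarrow> alg z \<in> G"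
    and R: "\<And>g. g \<in> G \<Longrightarrow> risk l P g = ereal (R g)"
  shows "integrable (training_space n P) (\<lambda>z. R (alg z))"
    and "expected_risk l n P alg = ereal (\<integral>z. R (alg z) \<partial>training_space n P)"
    and "has_ereal_expectation (training_space n P) (\<lambda>z. risk l P (alg z))"
proof -
  interpret T: prob_space "training_space n P"
    using P unfolding training_space_def data_distribution_def by (intro prob_space_PiM) auto
  \<comment> \<open>There is no sigma-algebra on \<open>G\<close>, so \<open>R (alg z)\<close>
    inherits its measurability from the risk of the output.\<close>
  have "(\<lambda>z. real_of_ereal (risk l P (alg z))) \<in> borel_measurable (training_space n P)"
    using measurable_risk[OF P alg] by measurable
  also have "?this \<longleftrightarrow> (\<lambda>z. R (alg z)) \<in> borel_measurable (training_space n P)"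
    using G R by (intro measurable_cong) simp
  finally have meas: "(\<lambda>z. R (alg z)) \<in> borel_measurable (training_space n P)" .
  show int: "integrable (training_space n P) (\<lambda>z. R (alg z))"
  proof (rule T.integrable_const_bound[where B = "\<Sum>g\<in>G. \<bar>R g\<bar>"])
    show "AE z in training_space n P. norm (R (alg z)) \<le> (\<Sum>g\<in>G. \<bar>R g\<bar>)"
      using G by (intro AE_I2) (auto intro: member_le_sum)
  qed (rule meas)
  show "expected_risk l n P alg = ereal (\<integral>z. R (alg z) \<partial>training_space n P)"
    "has_ereal_expectation (training_space n P) (\<lambda>z. risk l P (alg z))"
    unfolding expected_risk_def using G R by (auto intro!: ereal_expectation_real int)
qed

lemma loss_center_finite: "y \<in> Y \<Longrightarrow> a \<in> Y \<and> l y a < \<infinity>"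
  using exp_concave by (auto simp: unif_exp_concave_def)

text \<open>Comparison with the prediction \<open>a\<close>, whose loss is always finite, excludes
  infinite losses. Exchanging the two predictions turns the one-sided gap into a bound on the
  absolute difference.\<close>

lemma loss_gap_real:
  assumes "loss_gap Y l < \<infinity>"
  obtains L B where "B \<ge> 0" "loss_gap Y l = ereal B"
    "\<And>y y'. y \<in> Y \<Longrightarrow> y' \<in> Y \<Longrightarrow> l y y' = ereal (L y y')"
    "\<And>y y' y''. y \<in> Y \<Longrightarrow> y' \<in> Y \<Longrightarrow> y'' \<in> Y \<Longrightarrow> \<bar>L y y' - L y y''\<bar> \<le> B"
proof -
  have le: "l y y' - l y y'' \<le> loss_gap Y l" if "y \<in> Y" "y' \<in> Y" "y'' \<in> Y" for y y' y''
    unfolding loss_gap_def using that by (intro SUP_upper2[of "(y, y', y'')"]) auto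
  define L where "L y y' = real_of_ereal (l y y')" for y y'
  have L: "l y y' = ereal (L y y')" if y: "y \<in> Y" "y' \<in> Y" for y y'
  proof -
    have "l y y' \<noteq> \<infinity>"
    proof
      assume "l y y' = \<infinity>"
      with le[of y y' a] loss_center_finite[of y] y have "loss_gap Y l = \<infinity>"
        by (cases "l y a") auto
      with assms show False by simp
    qed
    with loss_not_minf[OF y] show ?thesis by (cases "l y y'") (auto simp: L_def)
  qed
  obtain y0 where y0: "y0 \<in> Y" using infinite_Y by (metis ex_in_conv finite.emptyI)
  have "0 \<le> loss_gap Y l" using le[OF y0 y0 y0] L[OF y0 y0] by (simp add: zero_ereal_def)
  with assms obtain B where B: "loss_gap Y l = ereal B" "B \<ge> 0" by (cases "loss_gap Y l") auto
  have "L y y' - L y y'' \<le> B" if "y \<in> Y" "y' \<in> Y" "y'' \<in> Y" for y y' y''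
    using le[OF that] that L by (simp add: B)
  then have "\<bar>L y y' - L y y''\<bar> \<le> B" if "y \<in> Y" "y' \<in> Y" "y'' \<in> Y" for y y' y''
    using that by (simp add: abs_le_iff)
  with that B L show thesis by blast
qed

text \<open>The cases depend on which of the positive and negative parts of the loss of a single
  \<open>g0\<close> have finite integral; bounded differences carry the answer over to the whole
  class. Only the integrable case needs the deviation bound.\<close>

lemma expected_risk_erm_le:
  assumes gap: "loss_gap Y l < \<infinity>" and G: "finite G" "G \<noteq> {}" "G \<subseteq> prediction_functions MX Y"
    and n: "n \<ge> 1" and P: "data_distribution MX Y P"
    and erm: "empirical_risk_minimizer MX Y l G n alg"
  shows "expected_risk l n P alg \<le>
    (MIN g\<in>G. risk l P g) + loss_gap Y l * ereal (sqrt (2 * ln (real (card G)) / real n))"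
proof -
  obtain L B where B: "B \<ge> 0" and gap_eq: "loss_gap Y l = ereal B"
    and L: "\<And>y y'. y \<in> Y \<Longrightarrow> y' \<in> Y \<Longrightarrow> l y y' = ereal (L y y')"
    and LB: "\<And>y y' y''. y \<in> Y \<Longrightarrow> y' \<in> Y \<Longrightarrow> y'' \<in> Y \<Longrightarrow> \<bar>L y y' - L y y''\<bar> \<le> B"
    using loss_gap_real[OF gap] by metis
  let ?T = "training_space n P"
  have prob: "prob_space P" using P by (simp add: data_distribution_def)
  interpret P: prob_space P by fact
  interpret T: prob_space ?T unfolding training_space_def by (intro prob_space_PiM prob)
  have alg: "learning_algorithm MX Y n alg" using erm by (simp add: empirical_risk_minimizer_def)
  have space_T: "space (training_space n (data_space MX Y)) = space ?T"
    by (rule sets_eq_imp_space_eq[OF training_space_cong[OF P, symmetric]])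
  have algG: "alg z \<in> G" if "z \<in> space ?T" for z
    using erm that by (auto simp: empirical_risk_minimizer_def is_arg_min_def space_T)
  note space_P = space_data_distribution[OF P]
  define r where "r g w = L (snd w) (g (fst w))" for g and w :: "'x \<times> real"
  have r: "pred_loss l g w = ereal (r g w)" if "g \<in> G" "w \<in> space P" for g w
    using that G(3) space_P L prediction_function_mem by (auto simp: pred_loss_def r_def)
  have r_close: "\<bar>r g w - r g' w\<bar> \<le> B" if "g \<in> G" "g' \<in> G" "w \<in> space P" for g g' w
    
    unfolding r_def using that G(3) space_P
    by (intro LB prediction_function_mem[of g] prediction_function_mem[of g']) auto
  have r_le: "r g w \<le> r g' w + B" "- r g w \<le> - r g' w + B"
    if "g \<in> G" "g' \<in> G" "w \<in> space P" for g g' w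
    using r_close[OF that] by (auto simp: abs_le_iff)
  have r_meas [measurable]: "r g \<in> borel_measurable P" if g: "g \<in> G" for g
  proof -
    have "(\<lambda>w. real_of_ereal (pred_loss l g w)) \<in> borel_measurable P"
      using measurable_pred_loss[OF P] g G(3) by (intro borel_measurable_real_of_ereal) auto
    also have "?this \<longleftrightarrow> r g \<in> borel_measurable P"
      using r[OF g] by (intro measurable_cong) simp
    finally show ?thesis .
  qed
  define pos where "pos g = (\<integral>\<^sup>+w. ennreal (r g w) \<partial>P)" for g
  define neg where "neg g = (\<integral>\<^sup>+w. ennreal (- r g w) \<partial>P)" for g
  have risk_eq: "risk l P g = enn2ereal (pos g) - enn2ereal (neg g)" if "g \<in> G" for g
    unfolding risk_def ereal_expectation_def pos_def neg_def
    by (intro arg_cong2[where f = "(-)"] arg_cong[where f = enn2ereal] nn_integral_cong)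
      (auto simp: r that)
  \<comment> \<open>Positive parts satisfy the same inequality up to \<open>B\<close>, and
    \<open>P\<close> has mass 1. Used with losses for the positive parts and with negated losses for
    the negative parts.\<close>
  have infinite_transfer: "(\<integral>\<^sup>+w. ennreal (u w) \<partial>P) = \<infinity>"
    if "(\<integral>\<^sup>+w. ennreal (v w) \<partial>P) = \<infinity>" "\<And>w. w \<in> space P \<Longrightarrow> v w \<le> u w + B" "u \<in> borel_measurable P" for u v
  proof -
    have "ennreal (v w) \<le> ennreal (u w) + ennreal B" if w: "w \<in> space P" for w
    proof -
      have "ennreal (v w) \<le> ennreal (max 0 (u w) + B)"
        using \<open>\<And>w. w \<in> space P \<Longrightarrow> v w \<le> u w + B\<close>[OF w] by (intro ennreal_leI) auto
      also have "\<dots> = ennreal (u w) + ennreal B" using B by (simp add: max_def ennreal_neg)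
      finally show ?thesis .
    qed
    then have "(\<integral>\<^sup>+w. ennreal (v w) \<partial>P) \<le> (\<integral>\<^sup>+w. ennreal (u w) + ennreal B \<partial>P)"
      by (intro nn_integral_mono)
    also have "\<dots> = (\<integral>\<^sup>+w. ennreal (u w) \<partial>P) + ennreal B"
      using that(3) by (simp add: nn_integral_add P.emeasure_space_1)
    finally show ?thesis using that(1) by (cases "\<integral>\<^sup>+w. ennreal (u w) \<partial>P") (auto simp: top_unique)
  qed
  obtain g0 where g0: "g0 \<in> G" using G by auto
  let ?b = "B * sqrt (2 * ln (real (card G)) / real n)"
  have rhs: "loss_gap Y l * ereal (sqrt (2 * ln (real (card G)) / real n)) = ereal ?b"
    by (simp add: gap_eq)
  consider (inf) "pos g0 = \<infinity>" | (minf) "pos g0 < \<infinity>" "neg g0 = \<infinity>" | (fin) "pos g0 < \<infinity>" "neg g0 < \<infinity>"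
    by (metis infinity_ennreal_def top.not_eq_extremum)
  then show ?thesis
  proof cases
    case inf
    have "pos g = \<infinity>" if g: "g \<in> G" for g
      unfolding pos_def
      by (rule infinite_transfer[OF inf[unfolded pos_def]]) (use g g0 r_le in auto)
    \<comment> \<open>The convention \<open>\<infinity> - \<infinity> = \<infinity>\<close> includes
      the case in which the negative part is infinite too.\<close>
    then have "risk l P g = \<infinity>" if "g \<in> G" for g using that by (simp add: risk_eq)
    then have "(MIN g\<in>G. risk l P g) = \<infinity>"
      using G by (metis (no_types, lifting) Min_in finite_imageI image_is_empty imageE)
    then show ?thesis by (simp add: rhs)
  next
    case minf
    have "neg g = \<infinity>" if g: "g \<in> G" for g
      unfolding neg_def
      by (rule infinite_transfer[OF minf(2)[unfolded neg_def]]) (use g g0 r_le in auto)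
    \<comment> \<open>An infinite positive part would turn the risk into \<open>\<infinity>\<close>
      instead of \<open>-\<infinity>\<close>.\<close>
    moreover have "pos g \<noteq> \<infinity>" if g: "g \<in> G" for g
    proof
      assume "pos g = \<infinity>"
      note inf = this[unfolded pos_def]
      have "pos g0 = \<infinity>"
        unfolding pos_def by (rule infinite_transfer[OF inf]) (use g g0 r_le in auto)
      with minf show False by simp
    qed
    ultimately have "risk l P g = -\<infinity>" if "g \<in> G" for g
      using that by (cases "pos g") (auto simp: risk_eq)
    then have "expected_risk l n P alg = ereal_expectation ?T (\<lambda>z. -\<infinity>)"
      unfolding expected_risk_def ereal_expectation_def
      by (intro arg_cong2[where f = "(-)"] arg_cong[where f = enn2ereal] nn_integral_cong)
        (auto simp: algG)
    also have "\<dots> = -\<infinity>"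
      by (simp add: ereal_expectation_def T.emeasure_space_1 e2ennreal_neg zero_ennreal.rep_eq)
    finally show ?thesis by simp
  next
    case fin
    have int: "integrable P (r g)" if g: "g \<in> G" for g
    proof -
      have "integrable P (r g0)"
        using fin g0 unfolding pos_def neg_def real_integrable_def by auto
      moreover have "integrable P (\<lambda>w. r g w - r g0 w)"
        using r_close[OF g g0] g g0 by (intro P.integrable_const_bound[where B = B]) (auto intro!: AE_I2)
      ultimately have "integrable P (\<lambda>w. r g0 w + (r g w - r g0 w))" by (rule Bochner_Integration.integrable_add)
      then show ?thesis by simp
    qed
    define R where "R g = (\<integral>w. r g w \<partial>P)" for g
    have R: "risk l P g = ereal (R g)" if "g \<in> G" for g
      unfolding risk_def R_def using r int that by (intro ereal_expectation_real) auto
    obtain g1 where g1: "g1 \<in> G" "\<And>g. g \<in> G \<Longrightarrow> R g1 \<le> R g"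
      using ex_min_if_finite[of "R ` G"] G
      by (metis (no_types, lifting) finite_imageI image_is_empty imageE imageI linorder_not_less)
    have min: "(MIN g\<in>G. risk l P g) = ereal (R g1)"
      using g1 G R by (intro Min_eqI) auto
    note alg_real = expected_risk_real[OF P alg G(1) algG R]
    \<comment> \<open>The deviations are those of the loss differences to the best element
      \<open>g1\<close>. For the minimizer the empirical mean of this difference is at most 0, so
      its excess risk is at most its own deviation.\<close>
    have "(\<integral>z. R (alg z) - R g1 \<partial>?T) \<le> ln (real (card G)) / s + s * (B\<^sup>2 / (2 * real n))" if s: "s > 0" for s
      unfolding training_space_def
    proof (rule integral_max_deviation_le[where W = "\<lambda>g w. r g w - r g1 w"])
      show "integrable (\<Pi>\<^sub>M j\<in>{..<n}. P) (\<lambda>z. R (alg z) - R g1)"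
        using alg_real(1) T.integrable_const unfolding training_space_def
        by (rule Bochner_Integration.integrable_diff)
      fix z assume "z \<in> space (\<Pi>\<^sub>M j\<in>{..<n}. P)"
      then have z: "z \<in> space ?T" by (simp add: training_space_def)
      then have zj: "z j \<in> space P" if "j < n" for j
        using that by (auto simp: training_space_def space_PiM)
      have emp: "emp_risk l n z g = ereal (\<Sum>j<n. r g (z j))" if "g \<in> G" for g
        unfolding emp_risk_def using r[OF that zj]
        by (simp add: pred_loss_def flip: sum_ereal)
      have "\<not> emp_risk l n z g1 < emp_risk l n z (alg z)"
        using erm z g1(1) by (auto simp: empirical_risk_minimizer_def is_arg_min_def space_T)
      then have "(\<Sum>j<n. r (alg z) (z j)) \<le> (\<Sum>j<n. r g1 (z j))"
        using emp g1 algG[OF z] by simp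
      then have "(\<Sum>j<n. r (alg z) (z j) - r g1 (z j)) / real n \<le> 0"
        by (simp add: sum_subtractf divide_nonpos_nonneg)
      moreover have "(\<integral>w. r (alg z) w - r g1 w \<partial>P) = R (alg z) - R g1"
        unfolding R_def using int g1 algG[OF z] by simp
      ultimately have "R (alg z) - R g1 \<le> (\<integral>w. r (alg z) w - r g1 w \<partial>P) -
          (\<Sum>j<n. r (alg z) (z j) - r g1 (z j)) / real n" by simp
      then show "\<exists>g\<in>G. R (alg z) - R g1 \<le> (\<integral>w. r g w - r g1 w \<partial>P) -
          (\<Sum>j<n. r g (z j) - r g1 (z j)) / real n"
        using algG[OF z] by blast
    qed (use prob G n s g1 r_close in auto)
    \<comment> \<open>Optimising over \<open>s\<close> is possible only here, because the expected
      excess risk does not depend on \<open>s\<close>.\<close>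
    then have "(\<integral>z. R (alg z) - R g1 \<partial>?T) \<le> 2 * sqrt (ln (real (card G)) * (B\<^sup>2 / (2 * real n)))"
      using G by (intro le_sqrt_of_le_scaled) (auto simp: Suc_le_eq card_gt_0_iff)
    also have "\<dots> = ?b"
    proof -
      have "ln (real (card G)) * (B\<^sup>2 / (2 * real n)) = (B / 2)\<^sup>2 * (2 * ln (real (card G)) / real n)"
        by (simp add: power2_eq_square)
      then show ?thesis using B by (simp only: real_sqrt_mult real_sqrt_abs)
    qed
    finally have "(\<integral>z. R (alg z) \<partial>?T) \<le> R g1 + ?b"
      using alg_real(1) by (simp add: T.prob_space)
    then show ?thesis by (simp add: rhs min alg_real(2))
  qed
qed

end

subsection \<open>Assouad's lemma\<close>

text \<open>Clearing the denominator leaves the square \<open>(3 * x - y)^2 / 8\<close>. Summed over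
  two probability weights, the subtracted term contributes exactly \<open>1 / 4\<close>.\<close>

lemma min_ge_harmonic:
  fixes x y :: real
  assumes "x \<ge> 0" "y \<ge> 0"
  shows "2 * (x * y / (x + y)) - (x + y) / 8 \<le> min x y"
proof -
  have *: "2 * (x * y / (x + y)) - (x + y) / 8 \<le> x" if "x \<ge> 0" "y \<ge> 0" for x y :: real
  proof (cases "x + y = 0")
    case False
    with that have "x + y > 0" by auto
    have "(x + (x + y) / 8) * (x + y) - 2 * (x * y) = (3 * x - y)\<^sup>2 / 8"
      by (simp add: field_simps power2_eq_square)
    then have "2 * (x * y) \<le> (x + (x + y) / 8) * (x + y)"
      by (smt (verit) zero_le_power2 divide_nonneg_nonneg)
    with \<open>x + y > 0\<close> have "2 * (x * y) / (x + y) \<le> x + (x + y) / 8"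
      by (simp add: pos_divide_le_eq)
    then show ?thesis by simp
  qed (use that in auto)
  from *[OF assms] *[OF assms(2,1)] show ?thesis
    by (simp add: add.commute mult.commute)
qed

text \<open>Both numerators equal \<open>x * y * (1 - \<xi>^2)\<close> and the denominators
  \<open>u\<close>, \<open>v\<close> add up to \<open>2 * (x + y)\<close>, so
  \<open>1 / u + 1 / v \<ge> 4 / (u + v)\<close> suffices. In the degenerate cases the right side is
  0.\<close>

lemma harmonic_step:
  fixes x y \<xi> :: real
  assumes "x \<ge> 0" "y \<ge> 0" "0 \<le> \<xi>" "\<xi> \<le> 1"
  shows "(x * (1 + \<xi>)) * (y * (1 - \<xi>)) / (x * (1 + \<xi>) + y * (1 - \<xi>)) +
         (x * (1 - \<xi>)) * (y * (1 + \<xi>)) / (x * (1 - \<xi>) + y * (1 + \<xi>))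
         \<ge> 2 * (1 - \<xi>\<^sup>2) * (x * y / (x + y))"
proof (cases "\<xi> = 1 \<or> x = 0 \<or> y = 0")
  case False
  then have pos: "x > 0" "y > 0" "\<xi> < 1" using assms by auto
  define u v where "u = x * (1 + \<xi>) + y * (1 - \<xi>)" and "v = x * (1 - \<xi>) + y * (1 + \<xi>)"
  have uv: "u > 0" "v > 0" unfolding u_def v_def
    using pos assms by (auto intro!: add_pos_pos mult_pos_pos add_pos_nonneg)
  have "4 / (u + v) \<le> 1 / u + 1 / v"
  proof -
    have "4 * (u * v) \<le> (u + v) * (u + v)"
      using zero_le_power2[of "u - v"] by (simp add: power2_eq_square algebra_simps)
    then show ?thesis using uv by (simp add: field_simps)
  qed
  moreover have uv_sum: "u + v = 2 * (x + y)" unfolding u_def v_def by (simp add: algebra_simps)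
  moreover have "4 / (2 * (x + y)) = 2 / (x + y)" using pos by (simp add: divide_simps)
  ultimately have "2 / (x + y) \<le> 1 / u + 1 / v" by (simp only:)
  moreover have "x * y * (1 - \<xi>\<^sup>2) \<ge> 0"
    using pos assms by (intro mult_nonneg_nonneg) (auto simp: power_le_one)
  ultimately have "x * y * (1 - \<xi>\<^sup>2) * (2 / (x + y)) \<le> x * y * (1 - \<xi>\<^sup>2) * (1 / u + 1 / v)"
    by (rule mult_left_mono)
  then have "2 * (1 - \<xi>\<^sup>2) * (x * y / (x + y)) \<le> x * y * (1 - \<xi>\<^sup>2) / u + x * y * (1 - \<xi>\<^sup>2) / v"
    by (simp add: distrib_left mult.commute mult.left_commute)
  moreover have eq: "x * (1 + \<xi>) * (y * (1 - \<xi>)) = x * y * (1 - \<xi>\<^sup>2)"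
    "x * (1 - \<xi>) * (y * (1 + \<xi>)) = x * y * (1 - \<xi>\<^sup>2)"
    by (simp_all add: power2_eq_square algebra_simps)
  ultimately show ?thesis
    unfolding u_def[symmetric] v_def[symmetric] eq by simp
qed auto

section \<open>Weights of labelled samples and their overlap\<close>

lemma sum_PiE_Suc:
  "(\<Sum>w\<in>PiE {..<Suc n} (\<lambda>_. S). f w) = (\<Sum>w\<in>PiE {..<n} (\<lambda>_. S). \<Sum>s\<in>S. f (w(n := s)))"
proof -
  have "(\<Sum>w\<in>PiE {..<Suc n} (\<lambda>_. S). f w) =
    (\<Sum>(s, w)\<in>S \<times> PiE {..<n} (\<lambda>_. S). f (w(n := s)))"
    unfolding lessThan_Suc PiE_insert_eq
    by (subst sum.reindex[OF inj_combinator]) (auto simp: case_prod_unfold)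
  also have "\<dots> = (\<Sum>s\<in>S. \<Sum>w\<in>PiE {..<n} (\<lambda>_. S). f (w(n := s)))"
    by (simp add: sum.cartesian_product)
  finally show ?thesis by (subst sum.swap)
qed

lemma prod_fun_upd_Suc:
  fixes p :: "'s \<Rightarrow> real"
  shows "(\<Prod>j<Suc n. p ((w(n := s)) j)) = (\<Prod>j<n. p (w j)) * p s"
proof -
  have "(\<Prod>j<n. p ((w(n := s)) j)) = (\<Prod>j<n. p (w j))" by (intro prod.cong) auto
  then show ?thesis by simp
qed

text \<open>The points are numbered from 0; \<open>\<sigma>\<close> is the set of points where the label \<open>True\<close> is
  the more probable one.\<close>

definition sign_weight :: "nat \<Rightarrow> real \<Rightarrow> nat set \<Rightarrow> nat \<times> bool \<Rightarrow> real" where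
  "sign_weight k \<xi> \<sigma> = (\<lambda>(i, b). (1 + (if (i \<in> \<sigma>) = b then \<xi> else - \<xi>)) / (2 * real k))"

definition sample_weight :: "nat \<Rightarrow> real \<Rightarrow> nat set \<Rightarrow> nat \<Rightarrow> (nat \<Rightarrow> nat \<times> bool) \<Rightarrow> real" where
  "sample_weight k \<xi> \<sigma> n w = (\<Prod>j<n. sign_weight k \<xi> \<sigma> (w j))"

abbreviation labelled :: "nat \<Rightarrow> (nat \<times> bool) set" where
  "labelled k \<equiv> {..<k} \<times> UNIV"

abbreviation samples :: "nat \<Rightarrow> nat \<Rightarrow> (nat \<Rightarrow> nat \<times> bool) set" where
  "samples k n \<equiv> PiE {..<n} (\<lambda>_. labelled k)"

text \<open>Symmetric difference with \<open>{i}\<close>: the neighbour of \<open>\<sigma>\<close>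
  on the hypercube in direction \<open>i\<close>.\<close>

definition flip :: "nat \<Rightarrow> nat set \<Rightarrow> nat set" where
  "flip i \<sigma> = (if i \<in> \<sigma> then \<sigma> - {i} else insert i \<sigma>)"

lemma flip_flip [simp]: "flip i (flip i \<sigma>) = \<sigma>"
  by (auto simp: flip_def)

lemma mem_flip: "j \<in> flip i \<sigma> \<longleftrightarrow> (if j = i then i \<notin> \<sigma> else j \<in> \<sigma>)"
  by (auto simp: flip_def)

lemma bij_betw_flip:
  assumes "i < k"
  shows "bij_betw (flip i) (Pow {..<k}) (Pow {..<k})"
  using assms by (intro bij_betw_byWitness[where f' = "flip i"]) (auto simp: flip_def)

lemma sum_labelled: "(\<Sum>s\<in>labelled k. f s) = (\<Sum>i<k. f (i, True) + f (i, False))"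
proof -
  have "(\<Sum>s\<in>labelled k. f s) = (\<Sum>i<k. \<Sum>b\<in>UNIV. f (i, b))"
    by (simp only: sum.cartesian_product case_prod_unfold prod.collapse)
  then show ?thesis by (simp add: UNIV_bool add.commute)
qed

lemma sign_weight_nonneg: "0 \<le> \<xi> \<Longrightarrow> \<xi> \<le> 1 \<Longrightarrow> 0 \<le> sign_weight k \<xi> \<sigma> s"
  by (cases s) (auto simp: sign_weight_def)

lemma sum_sign_weight: "k \<ge> 1 \<Longrightarrow> (\<Sum>s\<in>labelled k. sign_weight k \<xi> \<sigma> s) = 1"
proof -
  assume k: "k \<ge> 1"
  have "sign_weight k \<xi> \<sigma> (i, True) + sign_weight k \<xi> \<sigma> (i, False) = 1 / real k" for i
    by (simp add: sign_weight_def add_divide_distrib[symmetric])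
  then show ?thesis using k by (simp add: sum_labelled)
qed

lemma sample_weight_nonneg: "0 \<le> \<xi> \<Longrightarrow> \<xi> \<le> 1 \<Longrightarrow> 0 \<le> sample_weight k \<xi> \<sigma> n w"
  by (simp add: sample_weight_def prod_nonneg sign_weight_nonneg)

lemma sample_weight_Suc:
  "sample_weight k \<xi> \<sigma> (Suc n) (w(n := s)) = sample_weight k \<xi> \<sigma> n w * sign_weight k \<xi> \<sigma> s"
  unfolding sample_weight_def by (rule prod_fun_upd_Suc)

lemma sum_sample_weight: "k \<ge> 1 \<Longrightarrow> (\<Sum>w\<in>samples k n. sample_weight k \<xi> \<sigma> n w) = 1"
proof (induction n)
  case (Suc n)
  then show ?case
    by (simp add: sum_PiE_Suc sample_weight_Suc sum_distrib_left[symmetric] sum_sign_weight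
        del: PiE_UNIV_domain)
qed (simp add: sample_weight_def)

text \<open>Here \<open>x\<close> and \<open>y\<close> stand for the two weights of the earlier
  observations. As \<open>H\<close> is homogeneous, each point other than \<open>i\<close>
  contributes exactly \<open>H x y / k\<close>. Only point \<open>i\<close> separates the two
  weights, and by \<open>harmonic_step\<close> it loses at most the fraction \<open>\<xi>^2\<close>
  of its share.\<close>

lemma harmonic_sign_weight:
  assumes "0 \<le> \<xi>" "\<xi> \<le> 1" "i < k" "x \<ge> 0" "y \<ge> 0"
  shows "(\<Sum>s\<in>labelled k. (x * sign_weight k \<xi> \<sigma> s) * (y * sign_weight k \<xi> (flip i \<sigma>) s) /
            (x * sign_weight k \<xi> \<sigma> s + y * sign_weight k \<xi> (flip i \<sigma>) s))
         \<ge> (1 - \<xi>\<^sup>2 / real k) * (x * y / (x + y))"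
proof -
  define H where "H u v = u * v / (u + v)" for u v :: real
  have H_scale: "H (u * c) (v * c) = c * H u v" for u v c
  proof (cases "c = 0")
    case False
    have "u * c + v * c = (u + v) * c" by (simp add: distrib_right)
    with False show ?thesis by (simp add: H_def)
  qed (simp add: H_def)
  have H_scale_div: "H (u * p / c) (v * q / c) = H (u * p) (v * q) / c" for u v p q c
    using H_scale[of "u * p" "1 / c" "v * q"] by simp
  define T where "T j = H (x * sign_weight k \<xi> \<sigma> (j, True)) (y * sign_weight k \<xi> (flip i \<sigma>) (j, True))
    + H (x * sign_weight k \<xi> \<sigma> (j, False)) (y * sign_weight k \<xi> (flip i \<sigma>) (j, False))" for j
  have T_other: "T j = H x y / real k" if "j \<noteq> i" for j
  proof -
    have eq: "sign_weight k \<xi> (flip i \<sigma>) (j, b) = sign_weight k \<xi> \<sigma> (j, b)" for b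
      using that by (simp add: sign_weight_def mem_flip)
    have "sign_weight k \<xi> \<sigma> (j, True) + sign_weight k \<xi> \<sigma> (j, False) = 1 / real k"
      by (simp add: sign_weight_def add_divide_distrib[symmetric])
    then show ?thesis
      unfolding T_def eq H_scale by (simp flip: distrib_right)
  qed
  have T_i: "T i \<ge> (1 - \<xi>\<^sup>2) * H x y / real k"
  proof -
    \<comment> \<open>Whether \<open>i\<close> belongs to \<open>\<sigma>\<close> only decides which
      label gives which of the two terms.\<close>
    have "T i = (H (x * (1 + \<xi>)) (y * (1 - \<xi>)) + H (x * (1 - \<xi>)) (y * (1 + \<xi>))) / (2 * real k)"
      unfolding T_def
      by (auto simp: sign_weight_def mem_flip H_scale_div simp flip: add_divide_distrib)
    moreover have "\<dots> \<ge> (2 * (1 - \<xi>\<^sup>2) * H x y) / (2 * real k)"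
      using harmonic_step[OF assms(4,5,1,2)] unfolding H_def
      by (intro divide_right_mono) auto
    moreover have "(2 * (1 - \<xi>\<^sup>2) * H x y) / (2 * real k) = (1 - \<xi>\<^sup>2) * H x y / real k"
      by (simp only: mult.assoc mult_divide_mult_cancel_left_if) simp
    ultimately show ?thesis by linarith
  qed
  have "(\<Sum>j<k. T j) = T i + (\<Sum>j\<in>{..<k} - {i}. T j)"
    using \<open>i < k\<close> by (subst sum.remove[of _ i]) auto
  also have "(\<Sum>j\<in>{..<k} - {i}. T j) = (real k - 1) * (H x y / real k)"
    using \<open>i < k\<close> by (simp add: T_other of_nat_diff)
  also have "T i + \<dots> \<ge> (1 - \<xi>\<^sup>2) * H x y / real k + (real k - 1) * (H x y / real k)"
    using T_i by simp
  also have "(1 - \<xi>\<^sup>2) * H x y / real k + (real k - 1) * (H x y / real k)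
      = (1 - \<xi>\<^sup>2 / real k) * H x y"
    using \<open>i < k\<close> by (simp add: field_simps)
  finally show ?thesis
    unfolding sum_labelled T_def H_def by simp
qed

text \<open>The harmonic affinity, unlike the total variation distance, tensorises.\<close>

lemma harmonic_sample_weight:
  assumes "0 \<le> \<xi>" "\<xi> \<le> 1" "i < k"
  shows "(\<Sum>w\<in>samples k n. sample_weight k \<xi> \<sigma> n w * sample_weight k \<xi> (flip i \<sigma>) n w /
            (sample_weight k \<xi> \<sigma> n w + sample_weight k \<xi> (flip i \<sigma>) n w))
         \<ge> (1 - \<xi>\<^sup>2 / real k) ^ n / 2"
\<comment> \<open>The empty sample has weight 1 under both parameters, so the induction starts at
  \<open>1 * 1 / (1 + 1) = 1 / 2\<close>.\<close>
proof (induction n)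
  case (Suc n)
  let ?h = "\<lambda>w. sample_weight k \<xi> \<sigma> n w * sample_weight k \<xi> (flip i \<sigma>) n w /
            (sample_weight k \<xi> \<sigma> n w + sample_weight k \<xi> (flip i \<sigma>) n w)"
  have "\<xi>\<^sup>2 \<le> 1" using assms by (simp add: power_le_one)
  then have "\<xi>\<^sup>2 / real k \<le> 1" using assms by (simp add: divide_le_eq)
  then have "(1 - \<xi>\<^sup>2 / real k) ^ Suc n / 2 \<le> (1 - \<xi>\<^sup>2 / real k) * (\<Sum>w\<in>samples k n. ?h w)"
    using mult_left_mono[OF Suc, of "1 - \<xi>\<^sup>2 / real k"] by simp
  also have "\<dots> = (\<Sum>w\<in>samples k n. (1 - \<xi>\<^sup>2 / real k) * ?h w)"
    by (simp add: sum_distrib_left)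
  also have "\<dots> \<le> (\<Sum>w\<in>samples k n. \<Sum>s\<in>labelled k.
      (sample_weight k \<xi> \<sigma> n w * sign_weight k \<xi> \<sigma> s) *
      (sample_weight k \<xi> (flip i \<sigma>) n w * sign_weight k \<xi> (flip i \<sigma>) s) /
      (sample_weight k \<xi> \<sigma> n w * sign_weight k \<xi> \<sigma> s +
       sample_weight k \<xi> (flip i \<sigma>) n w * sign_weight k \<xi> (flip i \<sigma>) s))"
    by (intro sum_mono harmonic_sign_weight assms sample_weight_nonneg)
  finally show ?case
    unfolding sum_PiE_Suc sample_weight_Suc .
qed (simp add: sample_weight_def)

text \<open>By Bernoulli's inequality the harmonic affinity is at least
  \<open>(1 - 1/4) / 2 = 3/8\<close>, and \<open>2 * (3/8) - 2/8 = 1/2\<close>.\<close>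

lemma min_sample_weight:
  assumes "0 \<le> \<xi>" "\<xi> \<le> 1" "i < k" and n: "real n * \<xi>\<^sup>2 \<le> real k / 4"
  shows "(\<Sum>w\<in>samples k n. min (sample_weight k \<xi> \<sigma> n w) (sample_weight k \<xi> (flip i \<sigma>) n w)) \<ge> 1 / 2"
proof -
  let ?A = "sample_weight k \<xi> \<sigma> n" and ?B = "sample_weight k \<xi> (flip i \<sigma>) n"
  have "\<xi>\<^sup>2 \<le> 1" using assms by (simp add: power_le_one)
  then have "\<xi>\<^sup>2 / real k \<le> 1" using assms by (simp add: divide_le_eq)
  then have "1 + real n * (- (\<xi>\<^sup>2 / real k)) \<le> (1 - \<xi>\<^sup>2 / real k) ^ n"
    using Bernoulli_inequality[of "- (\<xi>\<^sup>2 / real k)" n] by simp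
  moreover have "real n * (\<xi>\<^sup>2 / real k) \<le> 1 / 4"
    using n \<open>i < k\<close> by (simp add: field_simps)
  ultimately have "3 / 8 \<le> (1 - \<xi>\<^sup>2 / real k) ^ n / 2" by simp
  also have "\<dots> \<le> (\<Sum>w\<in>samples k n. ?A w * ?B w / (?A w + ?B w))"
    by (rule harmonic_sample_weight[OF assms(1-3)])
  finally have "1 / 2 \<le> 2 * (\<Sum>w\<in>samples k n. ?A w * ?B w / (?A w + ?B w)) -
      ((\<Sum>w\<in>samples k n. ?A w) + (\<Sum>w\<in>samples k n. ?B w)) / 8"
    using \<open>i < k\<close> by (simp add: sum_sample_weight)
  also have "\<dots> = (\<Sum>w\<in>samples k n. 2 * (?A w * ?B w / (?A w + ?B w)) - (?A w + ?B w) / 8)"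
    by (simp add: sum_subtractf sum.distrib sum_distrib_left sum_divide_distrib add_divide_distrib)
  also have "\<dots> \<le> (\<Sum>w\<in>samples k n. min (?A w) (?B w))"
    by (intro sum_mono min_ge_harmonic sample_weight_nonneg assms)
  finally show ?thesis .
qed

text \<open>\<open>\<phi> w\<close> is the set of signs guessed from the sample \<open>w\<close>.
  Pairing \<open>\<sigma>\<close> with \<open>flip i \<sigma>\<close> shows that the error at point
  \<open>i\<close>, averaged over all \<open>\<sigma>\<close>, is at least \<open>1 / 4\<close>.
  Summing over the points, the average over \<open>\<sigma>\<close> is at least
  \<open>k / 4\<close>, so some \<open>\<sigma>\<close> reaches this value.\<close>

lemma assouad:
  assumes "0 \<le> \<xi>" "\<xi> \<le> 1" "k \<ge> 1" "real n * \<xi>\<^sup>2 \<le> real k / 4"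
  shows "\<exists>\<sigma>\<subseteq>{..<k}. real k / 4 \<le>
    (\<Sum>w\<in>samples k n. sample_weight k \<xi> \<sigma> n w * real (card {i\<in>{..<k}. (i \<in> \<phi> w) \<noteq> (i \<in> \<sigma>)}))"
proof (rule ccontr)
  define err where "err \<sigma> i = (\<Sum>w\<in>samples k n. sample_weight k \<xi> \<sigma> n w * of_bool ((i \<in> \<phi> w) \<noteq> (i \<in> \<sigma>)))"
    for \<sigma> i
  have card_eq: "(\<Sum>w\<in>samples k n. sample_weight k \<xi> \<sigma> n w * real (card {i\<in>{..<k}. (i \<in> \<phi> w) \<noteq> (i \<in> \<sigma>)}))
      = (\<Sum>i<k. err \<sigma> i)" for \<sigma>
  proof -
    have "real (card {i\<in>{..<k}. (i \<in> \<phi> w) \<noteq> (i \<in> \<sigma>)}) = (\<Sum>i<k. of_bool ((i \<in> \<phi> w) \<noteq> (i \<in> \<sigma>)))" for w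
      by (simp add: Int_def)
    then show ?thesis
      unfolding err_def by (subst sum.swap) (simp only: sum_distrib_left)
  qed
  assume "\<not> ?thesis"
  then have "(\<Sum>i<k. err \<sigma> i) < real k / 4" if "\<sigma> \<in> Pow {..<k}" for \<sigma>
    using that unfolding card_eq by (auto simp: not_le)
  then have "(\<Sum>\<sigma>\<in>Pow {..<k}. \<Sum>i<k. err \<sigma> i) < (\<Sum>\<sigma>\<in>Pow {..<k}. real k / 4)"
    by (intro sum_strict_mono) auto
  also have "\<dots> = (\<Sum>i<k. 2 ^ k / 4)" by (simp add: card_Pow)
  also have "\<dots> \<le> (\<Sum>i<k. \<Sum>\<sigma>\<in>Pow {..<k}. err \<sigma> i)"
  proof (rule sum_mono)
    fix i assume "i \<in> {..<k}"
    then have i: "i < k" by simp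
    have pair: "err \<sigma> i + err (flip i \<sigma>) i \<ge> 1 / 2" for \<sigma>
    proof -
      have "1 / 2 \<le> (\<Sum>w\<in>samples k n. min (sample_weight k \<xi> \<sigma> n w) (sample_weight k \<xi> (flip i \<sigma>) n w))"
        by (rule min_sample_weight) (use assms i in auto)
      \<comment> \<open>For each \<open>w\<close> the guess about \<open>i\<close> is wrong for
        exactly one of the two parameters, so the summand is one of the two weights.\<close>
      also have "\<dots> \<le> (\<Sum>w\<in>samples k n. sample_weight k \<xi> \<sigma> n w * of_bool ((i \<in> \<phi> w) \<noteq> (i \<in> \<sigma>)) +
          sample_weight k \<xi> (flip i \<sigma>) n w * of_bool ((i \<in> \<phi> w) \<noteq> (i \<in> flip i \<sigma>)))"
        by (intro sum_mono) (auto simp: mem_flip)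
      finally show ?thesis unfolding err_def by (simp add: sum.distrib)
    qed
    \<comment> \<open>Flipping permutes the parameters, so the sum over all pairs counts every error
      twice.\<close>
    have "(\<Sum>\<sigma>\<in>Pow {..<k}. err (flip i \<sigma>) i) = (\<Sum>\<sigma>\<in>Pow {..<k}. err \<sigma> i)"
      by (rule sum.reindex_bij_betw[OF bij_betw_flip[OF i]])
    then have "2 * (\<Sum>\<sigma>\<in>Pow {..<k}. err \<sigma> i) = (\<Sum>\<sigma>\<in>Pow {..<k}. err \<sigma> i + err (flip i \<sigma>) i)"
      by (simp add: sum.distrib)
    also have "\<dots> \<ge> (\<Sum>\<sigma>\<in>Pow {..<k}. 1 / 2)"
      by (intro sum_mono pair)
    finally show "2 ^ k / 4 \<le> (\<Sum>\<sigma>\<in>Pow {..<k}. err \<sigma> i)"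
      by (simp add: card_Pow)
  qed
  finally show False
    by (subst (asm) sum.swap) simp
qed

subsection \<open>Data distributions with finite support\<close>

text \<open>Split \<open>S\<close> by a measurable \<open>B\<close>. A measurable subset of
  \<open>S\<close> is determined by its traces on \<open>B\<close> and \<open>S - B\<close>, so one
  of these halves still has infinitely many measurable subsets. The induction continues inside that
  half \<open>D\<close>, and \<open>S - D\<close> becomes the additional set.\<close>

lemma infinite_sigma_algebra_disjoint_sets:
  assumes "S \<in> sets M" "infinite {C \<in> sets M. C \<subseteq> S}"
  shows "\<exists>A :: nat \<Rightarrow> 'a set. (\<forall>i<N. A i \<in> sets M \<and> A i \<noteq> {} \<and> A i \<subseteq> S) \<and>
    (\<forall>i<N. \<forall>j<N. i \<noteq> j \<longrightarrow> A i \<inter> A j = {})"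
  using assms
proof (induction N arbitrary: S)
  case (Suc N)
  let ?sub = "\<lambda>S. {C \<in> sets M. C \<subseteq> S}"
  have "infinite (?sub S - {{}, S})"
    by (rule Diff_infinite_finite[OF _ Suc.prems(2)]) simp
  then have "?sub S - {{}, S} \<noteq> {}" by (rule infinite_imp_nonempty)
  then obtain B where "B \<in> ?sub S - {{}, S}" by (meson ex_in_conv)
  then have B: "B \<in> sets M" "B \<subseteq> S" "B \<noteq> {}" "B \<noteq> S" by auto
  have "infinite (?sub B) \<or> infinite (?sub (S - B))"
  proof (rule ccontr)
    assume "\<not> ?thesis"
    then have "finite ((\<lambda>(C, D). C \<union> D) ` (?sub B \<times> ?sub (S - B)))" by simp
    moreover have "?sub S \<subseteq> (\<lambda>(C, D). C \<union> D) ` (?sub B \<times> ?sub (S - B))"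
    proof
      fix C assume C: "C \<in> ?sub S"
      have "(C \<inter> B, C - B) \<in> ?sub B \<times> ?sub (S - B)" using C B by auto
      moreover have "C = (\<lambda>(C, D). C \<union> D) (C \<inter> B, C - B)" by auto
      ultimately show "C \<in> (\<lambda>(C, D). C \<union> D) ` (?sub B \<times> ?sub (S - B))" by (rule rev_image_eqI)
    qed
    ultimately have "finite (?sub S)" by (rule rev_finite_subset)
    with Suc.prems(2) show False ..
  qed
  then obtain D where D: "D \<in> sets M" "D \<subseteq> S" "D \<noteq> S" "infinite (?sub D)"
  proof (elim disjE)
    assume "infinite (?sub B)"
    with B show thesis by (intro that[of B])
  next
    assume "infinite (?sub (S - B))"
    moreover have "S - B \<in> sets M" "S - B \<subseteq> S" "S - B \<noteq> S" using B Suc.prems(1) by auto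
    ultimately show thesis by (intro that[of "S - B"])
  qed
  from Suc.IH[OF D(1,4)] obtain A
    where A: "\<forall>i<N. A i \<in> sets M \<and> A i \<noteq> {} \<and> A i \<subseteq> D"
      "\<forall>i<N. \<forall>j<N. i \<noteq> j \<longrightarrow> A i \<inter> A j = {}"
    by (elim exE conjE)
  have last: "S - D \<in> sets M" "S - D \<noteq> {}" "S - D \<subseteq> S" using D Suc.prems(1) by auto
  have disj: "A i \<inter> (S - D) = {}" "(S - D) \<inter> A i = {}" if "i < N" for i
    using A(1) that by blast+
  show ?case
  proof (intro exI[of _ "A(N := S - D)"] conjI allI impI)
    fix i j assume "i < Suc N" "j < Suc N" "i \<noteq> j"
    then show "(A(N := S - D)) i \<inter> (A(N := S - D)) j = {}"
      using A(2) disj by (cases "i = N"; cases "j = N") (simp_all add: less_Suc_eq)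
  next
    fix i assume "i < Suc N"
    then have "i = N \<or> i < N" by auto
    then show "(A(N := S - D)) i \<in> sets M" "(A(N := S - D)) i \<noteq> {}" "(A(N := S - D)) i \<subseteq> S"
      using A(1) D(2) last by (elim disjE; fastforce)+
  qed
qed simp

lemma prob_space_real_point_measure:
  fixes p :: "'s \<Rightarrow> real"
  assumes "finite S" "\<And>s. s \<in> S \<Longrightarrow> 0 \<le> p s" "(\<Sum>s\<in>S. p s) = 1"
  shows "prob_space (point_measure S p)"
proof -
  have "(\<Sum>s\<in>S. ennreal (p s)) = 1" using assms by simp
  then show ?thesis using assms(1) by (intro prob_space_point_measure) auto
qed

text \<open>Both sides live on the discrete sigma-algebra of a finite set, so comparing the masses
  of singletons is enough.\<close>

lemma PiM_point_measure:
  fixes p :: "'s \<Rightarrow> real" and n :: nat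
  assumes S: "finite S" and p: "\<And>s. s \<in> S \<Longrightarrow> 0 \<le> p s" "(\<Sum>s\<in>S. p s) = 1"
  shows "PiM {..<n} (\<lambda>_. point_measure S p) = point_measure (PiE {..<n} (\<lambda>_. S)) (\<lambda>w. \<Prod>j<n. p (w j))"
proof (rule measure_eqI_finite)
  interpret N: prob_space "point_measure S p" by (rule prob_space_real_point_measure[OF S p])
  interpret product_sigma_finite "\<lambda>_::nat. point_measure S p" by unfold_locales
  have "sets (PiM {..<n} (\<lambda>_. point_measure S p)) = sets (PiM {..<n} (\<lambda>_. count_space S))"
    by (intro sets_PiM_cong) (simp_all add: sets_point_measure)
  also have "PiM {..<n} (\<lambda>_. count_space S) = count_space (PiE {..<n} (\<lambda>_. S))"
    using S by (intro count_space_PiM_finite) (auto simp: countable_finite)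
  finally show "sets (PiM {..<n} (\<lambda>_. point_measure S p)) = Pow (PiE {..<n} (\<lambda>_. S))" by simp
  show "sets (point_measure (PiE {..<n} (\<lambda>_. S)) (\<lambda>w. \<Prod>j<n. p (w j))) = Pow (PiE {..<n} (\<lambda>_. S))"
    by (simp add: sets_point_measure)
  show fin: "finite (PiE {..<n} (\<lambda>_. S))" using S by (intro finite_PiE) auto
  fix w assume w: "w \<in> PiE {..<n} (\<lambda>_. S)"
  then have wj: "w j \<in> S" if "j < n" for j using that by auto
  have "{w} = PiE {..<n} (\<lambda>j. {w j})" using w PiE_singleton[of w "{..<n}"] by (simp add: PiE_iff)
  then have "emeasure (PiM {..<n} (\<lambda>_. point_measure S p)) {w} =
      emeasure (PiM {..<n} (\<lambda>_. point_measure S p)) (PiE {..<n} (\<lambda>j. {w j}))" by simp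
  also have "\<dots> = (\<Prod>j<n. emeasure (point_measure S p) {w j})"
    using wj by (intro emeasure_PiM) (auto simp: sets_point_measure)
  also have "\<dots> = (\<Prod>j<n. ennreal (p (w j)))"
    using S wj by (intro prod.cong) (auto simp: emeasure_point_measure_finite)
  also have "\<dots> = ennreal (\<Prod>j<n. p (w j))"
    using p(1) wj by (intro prod_ennreal) auto
  also have "\<dots> = emeasure (point_measure (PiE {..<n} (\<lambda>_. S)) (\<lambda>w. \<Prod>j<n. p (w j))) {w}"
    using fin w by (simp add: emeasure_point_measure_finite)
  finally show "emeasure (PiM {..<n} (\<lambda>_. point_measure S p)) {w} =
    emeasure (point_measure (PiE {..<n} (\<lambda>_. S)) (\<lambda>w. \<Prod>j<n. p (w j))) {w}" .
qed

section \<open>Push-forwards of finite weights as data distributions\<close>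

context main_assumptions
begin

context
  fixes S :: "'s set" and p :: "'s \<Rightarrow> real" and h :: "'s \<Rightarrow> 'x \<times> real" and P
  assumes S: "finite S" and p: "\<And>s. s \<in> S \<Longrightarrow> 0 \<le> p s" "(\<Sum>s\<in>S. p s) = 1"
    and h: "\<And>s. s \<in> S \<Longrightarrow> snd (h s) \<in> Y"
  defines "P \<equiv> distr (point_measure S p) (data_space MX Y) h"
begin

text \<open>Every map out of a finite discrete space into the data space is measurable, so the
  push-forward lives on the full data sigma-algebra even if points are not measurable there.\<close>

lemma finite_support_measurable: "h \<in> point_measure S p \<rightarrow>\<^sub>M data_space MX Y"
  using h by (auto simp: space_data_space mem_Times_iff)

lemma data_distribution_finite_support: "data_distribution MX Y P"
  unfolding data_distribution_def P_def
  using prob_space.prob_space_distr[OF prob_space_real_point_measure[OF S p] finite_support_measurable]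
  by simp

lemma nn_integral_finite_support:
  assumes "f \<in> borel_measurable P"
  shows "(\<integral>\<^sup>+w. f w \<partial>P) = (\<Sum>s\<in>S. ennreal (p s) * f (h s))"
proof -
  have "f \<in> borel_measurable (data_space MX Y)" using assms by (simp add: P_def)
  then show ?thesis
    unfolding P_def by (subst nn_integral_distr[OF finite_support_measurable])
      (auto simp: nn_integral_point_measure_finite S)
qed

lemma measure_finite_support:
  assumes "A \<in> sets (data_space MX Y)" "h ` S \<subseteq> A"
  shows "measure P A = 1"
proof -
  interpret N: prob_space "point_measure S p" by (rule prob_space_real_point_measure[OF S p])
  have "h -` A \<inter> space (point_measure S p) = space (point_measure S p)"
    using assms(2) by (auto simp: space_point_measure)
  then show ?thesis
    unfolding P_def using assms(1) finite_support_measurable by (simp add: measure_distr N.prob_space)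
qed

lemma measure_two_labels:
  assumes "y \<in> Y" "\<And>s. s \<in> S \<Longrightarrow> snd (h s) \<in> {2 * a - y, y}"
  shows "measure P {z \<in> space P. snd z \<in> {2 * a - y, y}} = 1"
proof (rule measure_finite_support)
  have eq: "{z \<in> space P. snd z \<in> {2 * a - y, y}} = space MX \<times> {2 * a - y, y}"
    using assms(1) symmetric_Y space_data_distribution[OF data_distribution_finite_support]
    by (auto simp: space_MX)
  have "{2 * a - y, y} = Y \<inter> {2 * a - y, y}" using assms(1) symmetric_Y by auto
  then have "{2 * a - y, y} \<in> sets (output_space Y)"
    unfolding output_space_def sets_restrict_space by (rule image_eqI) simp
  then show "{z \<in> space P. snd z \<in> {2 * a - y, y}} \<in> sets (data_space MX Y)"
    unfolding eq data_space_def by (intro pair_measureI) auto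
  show "h ` S \<subseteq> {z \<in> space P. snd z \<in> {2 * a - y, y}}"
    unfolding eq using assms(2) by (intro image_subsetI mem_Times_iff[THEN iffD2] conjI) (auto simp: space_MX)
qed

lemma risk_finite_support:
  assumes g: "g \<in> prediction_functions MX Y"
    and loss: "\<And>s. s \<in> S \<Longrightarrow> l (snd (h s)) (g (fst (h s))) = ereal (c s)"
  shows "risk l P g = ereal (\<Sum>s\<in>S. p s * c s)" and "has_ereal_expectation P (pred_loss l g)"
proof -
  note [measurable] = measurable_pred_loss[OF data_distribution_finite_support g]
  have pos: "(\<integral>\<^sup>+w. e2ennreal (pred_loss l g w) \<partial>P) = ennreal (\<Sum>s\<in>S. p s * max 0 (c s))"
  proof -
    have "(\<integral>\<^sup>+w. e2ennreal (pred_loss l g w) \<partial>P) = (\<Sum>s\<in>S. ennreal (p s) * e2ennreal (pred_loss l g (h s)))"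
      by (rule nn_integral_finite_support) measurable
    also have "\<dots> = (\<Sum>s\<in>S. ennreal (p s * max 0 (c s)))"
      using p loss by (intro sum.cong) (auto simp: pred_loss_def ennreal_mult max_def ennreal_neg)
    finally show ?thesis using p by simp
  qed
  have neg: "(\<integral>\<^sup>+w. e2ennreal (- pred_loss l g w) \<partial>P) = ennreal (\<Sum>s\<in>S. p s * max 0 (- c s))"
  proof -
    have "(\<integral>\<^sup>+w. e2ennreal (- pred_loss l g w) \<partial>P) = (\<Sum>s\<in>S. ennreal (p s) * e2ennreal (- pred_loss l g (h s)))"
      by (rule nn_integral_finite_support) measurable
    also have "\<dots> = (\<Sum>s\<in>S. ennreal (p s * max 0 (- c s)))"
      using p loss by (intro sum.cong) (auto simp: pred_loss_def ennreal_mult max_def ennreal_neg)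
    finally show ?thesis using p by simp
  qed
  have "(\<Sum>s\<in>S. p s * max 0 (c s)) \<ge> 0" "(\<Sum>s\<in>S. p s * max 0 (- c s)) \<ge> 0"
    using p by (auto intro!: sum_nonneg)
  moreover have "(\<Sum>s\<in>S. p s * max 0 (c s)) - (\<Sum>s\<in>S. p s * max 0 (- c s)) = (\<Sum>s\<in>S. p s * c s)"
    unfolding sum_subtractf[symmetric] by (intro sum.cong) (auto simp: max_def)
  ultimately show "risk l P g = ereal (\<Sum>s\<in>S. p s * c s)"
    unfolding risk_def ereal_expectation_def pos neg by simp
  show "has_ereal_expectation P (pred_loss l g)"
    unfolding has_ereal_expectation_def pos neg by simp
qed

text \<open>One atom of positive mass makes the positive part infinite. The negative part is a
  finite sum of finite terms, since the loss is never \<open>-\<infinity>\<close>.\<close>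

lemma risk_infinite:
  assumes g: "g \<in> prediction_functions MX Y"
    and s: "s \<in> S" "p s > 0" "l (snd (h s)) (g (fst (h s))) = \<infinity>"
  shows "risk l P g = \<infinity>" and "has_ereal_expectation P (pred_loss l g)"
proof -
  note [measurable] = measurable_pred_loss[OF data_distribution_finite_support g]
  have "(\<integral>\<^sup>+w. e2ennreal (pred_loss l g w) \<partial>P) = (\<Sum>s\<in>S. ennreal (p s) * e2ennreal (pred_loss l g (h s)))"
    by (rule nn_integral_finite_support) measurable
  also have "\<dots> \<ge> ennreal (p s) * e2ennreal (pred_loss l g (h s))"
    using s S by (intro member_le_sum) auto
  also have "ennreal (p s) * e2ennreal (pred_loss l g (h s)) = \<top>"
    using s by (simp add: pred_loss_def ennreal_mult_top)
  finally have pos: "(\<integral>\<^sup>+w. e2ennreal (pred_loss l g w) \<partial>P) = \<top>" by (simp add: top_unique)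
  show "risk l P g = \<infinity>"
    unfolding risk_def ereal_expectation_def pos by simp
  have "(\<integral>\<^sup>+w. e2ennreal (- pred_loss l g w) \<partial>P) = (\<Sum>s\<in>S. ennreal (p s) * e2ennreal (- pred_loss l g (h s)))"
    by (rule nn_integral_finite_support) measurable
  also have "\<dots> < \<infinity>"
  proof -
    have "e2ennreal (- pred_loss l g (h s)) \<noteq> \<top>" if "s \<in> S" for s
      using loss_not_minf[OF h[OF that] prediction_function_mem[OF g]]
      by (cases "l (snd (h s)) (g (fst (h s)))") (auto simp: pred_loss_def e2ennreal_neg)
    then show ?thesis using S by (simp add: ennreal_mult_less_top less_top)
  qed
  finally show "has_ereal_expectation P (pred_loss l g)"
    by (simp add: has_ereal_expectation_def)
qed

text \<open>The product of push-forwards is the push-forward of the product along the coordinatewise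
  map. \<open>compose {..<n} h\<close> is used because points of the product space must be
  extensional.\<close>

lemma integral_training_finite_support:
  fixes F :: "(nat \<Rightarrow> 'x \<times> real) \<Rightarrow> real"
  assumes F: "F \<in> borel_measurable (training_space n P)"
  shows "(\<integral>z. F z \<partial>training_space n P) =
    (\<Sum>w\<in>PiE {..<n} (\<lambda>_. S). (\<Prod>j<n. p (w j)) * F (compose {..<n} h w))"
proof -
  let ?N = "point_measure S p"
  have N: "prob_space ?N" by (rule prob_space_real_point_measure[OF S p])
  have P: "prob_space P" using data_distribution_finite_support by (simp add: data_distribution_def)
  have hP: "h \<in> ?N \<rightarrow>\<^sub>M P" unfolding P_def using finite_support_measurable by simp
  have h_space: "h s \<in> space P" if "s \<in> S" for s
    using measurable_space[OF hP] that by (simp add: space_point_measure)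
  have "distr ?N P h = P" unfolding P_def by (intro distr_cong) auto
  then have T: "training_space n P = distr (PiM {..<n} (\<lambda>_. ?N)) (training_space n P) (compose {..<n} h)"
    unfolding training_space_def
    using distr_PiM_finite_prob_space'[of "{..<n}" "\<lambda>_. ?N" "\<lambda>_. P" h] N P hP by simp
  have point: "PiM {..<n} (\<lambda>_. ?N) = point_measure (PiE {..<n} (\<lambda>_. S)) (\<lambda>w. \<Prod>j<n. p (w j))"
    by (rule PiM_point_measure[OF S p])
  have meas: "compose {..<n} h \<in> PiM {..<n} (\<lambda>_. ?N) \<rightarrow>\<^sub>M training_space n P"
  proof -
    have "compose {..<n} h w \<in> space (training_space n P)" if "w \<in> PiE {..<n} (\<lambda>_. S)" for w
      using that h_space by (auto simp: training_space_def space_PiM compose_def PiE_iff)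
    then have "compose {..<n} h \<in> point_measure (PiE {..<n} (\<lambda>_. S)) (\<lambda>w. ennreal (\<Prod>j<n. p (w j)))
        \<rightarrow>\<^sub>M training_space n P"
      unfolding measurable_point_measure_eq1 by (rule Pi_I)
    then show ?thesis by (simp only: point)
  qed
  have "(\<integral>z. F z \<partial>training_space n P) =
      (\<integral>z. F z \<partial>distr (PiM {..<n} (\<lambda>_. ?N)) (training_space n P) (compose {..<n} h))"
    using T by simp
  also have "\<dots> = (\<integral>w. F (compose {..<n} h w) \<partial>PiM {..<n} (\<lambda>_. ?N))"
    by (rule integral_distr[OF meas F])
  also have "\<dots> = (\<Sum>w\<in>PiE {..<n} (\<lambda>_. S). (\<Prod>j<n. p (w j)) * F (compose {..<n} h w))"
    unfolding point by (subst lebesgue_integral_point_measure_finite) (use S p in \<open>auto intro!: finite_PiE prod_nonneg\<close>)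
  finally show ?thesis .
qed

end

section \<open>Hard distributions and the class of prediction functions\<close>

lemma loss_reflect: "y \<in> Y \<Longrightarrow> y' \<in> Y \<Longrightarrow> l (2 * a - y) y' = l y (2 * a - y')"
  using symmetrical symmetric_Y[of y'] by (auto simp: symmetrical_loss_def)

lemma exists_hard_distribution:
  fixes x :: "nat \<Rightarrow> 'x" and u d :: real
  assumes y: "y1 \<in> Y" "y1 > a" "yt1 \<in> Y" "yt1 > a"
    and u: "l y1 yt1 = ereal u" "l y1 (2 * a - yt1) = ereal (u + d)" and d: "d > 0"
    and G: "finite G" "G \<subseteq> prediction_functions MX Y"
      "\<And>g i. g \<in> G \<Longrightarrow> i < k \<Longrightarrow> g (x i) \<in> {yt1, 2 * a - yt1}"
    and full: "\<And>\<sigma>. \<sigma> \<subseteq> {..<k} \<Longrightarrow> \<xi> \<noteq> 0 \<Longrightarrow> \<exists>g\<in>G. \<forall>i<k. g (x i) = yt1 \<longleftrightarrow> i \<in> \<sigma>"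
    and "G \<noteq> {}" and \<xi>: "0 \<le> \<xi>" "\<xi> \<le> 1" "real n * \<xi>\<^sup>2 \<le> real k / 4" and k: "k \<ge> 1"
    and alg: "learning_algorithm MX Y n alg"
    and algG: "\<And>z. z \<in> space (training_space n (data_space MX Y)) \<Longrightarrow> alg z \<in> G"
  shows "\<exists>P. data_distribution MX Y P \<and>
    measure P {z \<in> space P. snd z \<in> {2 * a - y1, y1}} = 1 \<and>
    risks_exist l n P G alg \<and>
    expected_risk l n P alg \<ge> (MIN g\<in>G. risk l P g) + ereal (d * \<xi> / 4)"
proof -
  define h where "h = (\<lambda>(i, b). (x i, if b then y1 else 2 * a - y1))"
  define hits where "hits g = {i. g (x i) = yt1}" for g :: "'x \<Rightarrow> real"
  \<comment> \<open>The guess made from \<open>w\<close> depends on \<open>alg\<close> and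
    \<open>h\<close> but not on \<open>\<sigma>\<close>, so \<open>\<sigma>\<close> can be chosen
    against it.\<close>
  obtain \<sigma> where \<sigma>: "\<sigma> \<subseteq> {..<k}"
    and hard: "real k / 4 \<le> (\<Sum>w\<in>samples k n. sample_weight k \<xi> \<sigma> n w *
      real (card {i\<in>{..<k}. (i \<in> hits (alg (compose {..<n} h w))) \<noteq> (i \<in> \<sigma>)}))"
    using assouad[OF \<xi>(1,2) k \<xi>(3), of "\<lambda>w. hits (alg (compose {..<n} h w))"]
    by (elim exE conjE) (rule that)
  define p where "p = sign_weight k \<xi> \<sigma>"
  define P where "P = distr (point_measure (labelled k) p) (data_space MX Y) h"
  have "finite (labelled k)" by simp
  moreover have "0 \<le> p s" for s unfolding p_def using \<xi> by (simp add: sign_weight_nonneg)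
  moreover have "(\<Sum>s\<in>labelled k. p s) = 1" unfolding p_def using k by (rule sum_sign_weight)
  moreover have "snd (h s) \<in> Y" for s
    using y(1) symmetric_Y[OF y(1)] by (simp add: h_def case_prod_unfold)
  ultimately have "finite (labelled k)" "\<And>s. s \<in> labelled k \<Longrightarrow> 0 \<le> p s"
    "(\<Sum>s\<in>labelled k. p s) = 1" "\<And>s. s \<in> labelled k \<Longrightarrow> snd (h s) \<in> Y" by auto
  note hyps = this
  have P: "data_distribution MX Y P"
    unfolding P_def by (rule data_distribution_finite_support[where h = h, OF hyps])
  have space_T: "space (training_space n (data_space MX Y)) = space (training_space n P)"
    by (rule sets_eq_imp_space_eq[OF training_space_cong[OF P, symmetric]])
  define err where "err g = real (card {i\<in>{..<k}. (i \<in> hits g) \<noteq> (i \<in> \<sigma>)})" for g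
  \<comment> \<open>The risk with all signs right: the rarer label, of probability
    \<open>(1 - \<xi>) / 2\<close>, still costs \<open>d\<close> more.\<close>
  define base where "base = u + d * (1 - \<xi>) / 2"
  define R where "R g = base + d * \<xi> / real k * err g" for g
  have loss: "l (snd (h s)) (g (fst (h s))) =
      ereal (u + d * of_bool (snd s \<noteq> (fst s \<in> hits g)))" if "g \<in> G" "s \<in> labelled k" for g s
  proof -
    have "2 * a - yt1 \<in> Y" "2 * a - yt1 \<noteq> yt1" using y symmetric_Y[OF y(3)] by auto
    then show ?thesis
      using G(3)[OF that(1), of "fst s"] that(2) u y loss_reflect[of y1 yt1] loss_reflect[of y1 "2 * a - yt1"]
      by (auto simp: h_def hits_def case_prod_unfold)
  qed
  have pair: "p (i, True) * (u + d * of_bool (True \<noteq> c)) + p (i, False) * (u + d * of_bool (False \<noteq> c))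
      = base / real k + d * \<xi> / real k * of_bool (c \<noteq> (i \<in> \<sigma>))" for i c
    using k unfolding p_def sign_weight_def base_def
    by (cases c; cases "i \<in> \<sigma>") (auto simp: field_simps)
  have sum_R: "(\<Sum>s\<in>labelled k. p s * (u + d * of_bool (snd s \<noteq> (fst s \<in> hits g)))) = R g" for g
  proof -
    have "(\<Sum>s\<in>labelled k. p s * (u + d * of_bool (snd s \<noteq> (fst s \<in> hits g))))
        = (\<Sum>i<k. base / real k + d * \<xi> / real k * of_bool ((i \<in> hits g) \<noteq> (i \<in> \<sigma>)))"
      unfolding sum_labelled fst_conv snd_conv pair ..
    also have "\<dots> = base + d * \<xi> / real k * (\<Sum>i<k. of_bool ((i \<in> hits g) \<noteq> (i \<in> \<sigma>)))"
      using k by (simp only: sum.distrib sum_distrib_left) simp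
    also have "(\<Sum>i<k. of_bool ((i \<in> hits g) \<noteq> (i \<in> \<sigma>)) :: real) = err g"
      by (simp add: err_def Int_def)
    finally show ?thesis by (simp only: R_def)
  qed
  have Gpred: "g \<in> prediction_functions MX Y" if "g \<in> G" for g using that G by auto
  have risk: "risk l P g = ereal (R g)" and exist: "has_ereal_expectation P (pred_loss l g)"
    if g: "g \<in> G" for g
  proof -
    show "risk l P g = ereal (R g)" unfolding P_def sum_R[symmetric]
      by (rule risk_finite_support(1)[where h = h, OF hyps Gpred[OF g] loss[OF g]])
    show "has_ereal_expectation P (pred_loss l g)" unfolding P_def
      by (rule risk_finite_support(2)[where h = h, OF hyps Gpred[OF g] loss[OF g]])
  qed
  have algG': "alg z \<in> G" if "z \<in> space (training_space n P)" for z
    using algG that space_T by simp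
  have alg_int: "integrable (training_space n P) (\<lambda>z. R (alg z))"
    by (rule expected_risk_real(1)[OF P alg G(1) algG' risk])
  have alg_eq: "expected_risk l n P alg = ereal (\<integral>z. R (alg z) \<partial>training_space n P)"
    by (rule expected_risk_real(2)[OF P alg G(1) algG' risk])
  have alg_exist: "has_ereal_expectation (training_space n P) (\<lambda>z. risk l P (alg z))"
    by (rule expected_risk_real(3)[OF P alg G(1) algG' risk])
  have "(\<integral>z. R (alg z) \<partial>training_space n P) =
      (\<Sum>w\<in>samples k n. sample_weight k \<xi> \<sigma> n w * R (alg (compose {..<n} h w)))"
    unfolding sample_weight_def p_def[symmetric] P_def
    by (rule integral_training_finite_support[where h = h, OF hyps])
      (use alg_int in \<open>auto simp: P_def\<close>)
  also have "\<dots> = (\<Sum>w\<in>samples k n. sample_weight k \<xi> \<sigma> n w * base + d * \<xi> / real k *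
      (sample_weight k \<xi> \<sigma> n w * err (alg (compose {..<n} h w))))"
    unfolding R_def by (intro sum.cong refl) (simp add: distrib_left)
  also have "\<dots> = base + d * \<xi> / real k * (\<Sum>w\<in>samples k n. sample_weight k \<xi> \<sigma> n w * err (alg (compose {..<n} h w)))"
    unfolding sum.distrib sum_distrib_left[symmetric] sum_distrib_right[symmetric]
    using sum_sample_weight[OF k] by simp
  also have "\<dots> \<ge> base + d * \<xi> / real k * (real k / 4)"
    using hard d \<xi> unfolding err_def by (intro add_left_mono mult_left_mono) auto
  finally have lower: "base + d * \<xi> / 4 \<le> (\<integral>z. R (alg z) \<partial>training_space n P)"
    using k by simp
  obtain g where g: "g \<in> G" "R g = base"
  proof (cases "\<xi> = 0")
    case True
    then show thesis using that \<open>G \<noteq> {}\<close> by (auto simp: R_def)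
  next
    case False
    from full[OF \<sigma> False] obtain g where g: "g \<in> G" "\<forall>i<k. g (x i) = yt1 \<longleftrightarrow> i \<in> \<sigma>" by blast
    then have "{i\<in>{..<k}. (i \<in> hits g) \<noteq> (i \<in> \<sigma>)} = {}" by (auto simp: hits_def)
    then have "err g = 0" unfolding err_def by (simp only: card.empty of_nat_0)
    with g(1) show thesis using that by (simp add: R_def)
  qed
  have "(MIN g\<in>G. risk l P g) \<le> risk l P g"
    using g(1) G(1) by (intro Min_le finite_imageI imageI)
  also have "risk l P g = ereal base" using risk[OF g(1)] g(2) by simp
  finally have "(MIN g\<in>G. risk l P g) \<le> ereal base" .
  then have "(MIN g\<in>G. risk l P g) + ereal (d * \<xi> / 4) \<le> ereal (base + d * \<xi> / 4)"
    using add_right_mono[of _ "ereal base" "ereal (d * \<xi> / 4)"] by simp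
  also have "\<dots> \<le> expected_risk l n P alg" unfolding alg_eq using lower by simp
  finally have "(MIN g\<in>G. risk l P g) + ereal (d * \<xi> / 4) \<le> expected_risk l n P alg" .
  moreover have "measure P {z \<in> space P. snd z \<in> {2 * a - y1, y1}} = 1"
    unfolding P_def
    by (rule measure_two_labels[where h = h, OF hyps]) (use y in \<open>auto simp: h_def case_prod_unfold\<close>)
  ultimately show ?thesis
    using P exist alg_exist unfolding risks_exist_def by (intro exI[of _ P] conjI ballI)
qed

text \<open>At the single input \<open>x\<close> the labels \<open>y1\<close> and
  \<open>2 * a - y1\<close> are equally likely, and each of the two possible predictions has
  infinite loss on one of them.\<close>

lemma exists_infinite_risk_distribution:
  assumes y: "y1 \<in> Y" "yt1 \<in> Y" and inf: "l y1 (2 * a - yt1) = \<infinity>"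
    and G: "finite G" "G \<noteq> {}" "G \<subseteq> prediction_functions MX Y"
      "\<And>g. g \<in> G \<Longrightarrow> g x \<in> {yt1, 2 * a - yt1}"
    and alg: "learning_algorithm MX Y n alg"
    and algG: "\<And>z. z \<in> space (training_space n (data_space MX Y)) \<Longrightarrow> alg z \<in> G"
  shows "\<exists>P. data_distribution MX Y P \<and>
    measure P {z \<in> space P. snd z \<in> {2 * a - y1, y1}} = 1 \<and>
    risks_exist l n P G alg \<and> expected_risk l n P alg = \<infinity>"
proof -
  define h where "h = (\<lambda>b. (x, if b then y1 else 2 * a - y1))"
  define p where "p = (\<lambda>b::bool. 1 / 2 :: real)"
  define P where "P = distr (point_measure UNIV p) (data_space MX Y) h"
  have hyps: "finite (UNIV :: bool set)" "\<And>s. s \<in> UNIV \<Longrightarrow> 0 \<le> p s" "(\<Sum>s\<in>UNIV. p s) = 1"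
    "\<And>s. s \<in> UNIV \<Longrightarrow> snd (h s) \<in> Y"
    using y(1) symmetric_Y[OF y(1)] by (simp_all add: p_def h_def UNIV_bool)
  have P: "data_distribution MX Y P"
    unfolding P_def by (rule data_distribution_finite_support[where h = h, OF hyps])
  interpret T: prob_space "training_space n P"
    using P unfolding training_space_def data_distribution_def by (intro prob_space_PiM) auto
  have space_T: "space (training_space n (data_space MX Y)) = space (training_space n P)"
    by (rule sets_eq_imp_space_eq[OF training_space_cong[OF P, symmetric]])
  have risk: "risk l P g = \<infinity>" and exist: "has_ereal_expectation P (pred_loss l g)"
    if g: "g \<in> G" for g
  proof -
    have gp: "g \<in> prediction_functions MX Y" using g G by auto
    \<comment> \<open>The boolean selects the label on the opposite side of \<open>a\<close> from
      the prediction.\<close>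
    have "l (snd (h (g x \<noteq> yt1))) (g (fst (h (g x \<noteq> yt1)))) = \<infinity>"
      using G(4)[OF g] inf loss_reflect[OF y] by (auto simp: h_def)
    then show "risk l P g = \<infinity>" "has_ereal_expectation P (pred_loss l g)"
      using risk_infinite[where h = h and s = "g x \<noteq> yt1", OF hyps gp, folded P_def]
      by (simp_all add: p_def)
  qed
  have inf_risk: "risk l P (alg z) = \<infinity>" if "z \<in> space (training_space n P)" for z
    using that algG risk space_T by auto
  have pos: "(\<integral>\<^sup>+z. e2ennreal (risk l P (alg z)) \<partial>training_space n P) = \<top>"
    using T.emeasure_space_1 by (subst nn_integral_cong[where v = "\<lambda>_. \<top>"]) (auto simp: inf_risk)
  have neg: "(\<integral>\<^sup>+z. e2ennreal (- risk l P (alg z)) \<partial>training_space n P) = 0"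
    by (subst nn_integral_cong[where v = "\<lambda>_. 0"]) (auto simp: inf_risk e2ennreal_neg)
  have "expected_risk l n P alg = \<infinity>"
    unfolding expected_risk_def ereal_expectation_def pos by simp
  moreover have "has_ereal_expectation (training_space n P) (\<lambda>z. risk l P (alg z))"
    unfolding has_ereal_expectation_def neg using measurable_risk[OF P alg] by simp
  moreover have "measure P {z \<in> space P. snd z \<in> {2 * a - y1, y1}} = 1"
    unfolding P_def
    by (rule measure_two_labels[where h = h, OF hyps]) (use y in \<open>auto simp: h_def case_prod_unfold\<close>)
  ultimately show ?thesis
    using P exist by (intro exI[of _ P] conjI) (auto simp: risks_exist_def)
qed

text \<open>Functions equal to \<open>y\<close> exactly on a union of disjoint measurable sets
  realise every pattern at one point per set. The \<open>m\<close> first points carry the signs; one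
  more set leaves room for up to \<open>2 ^ Suc m\<close> functions, so that the class can have
  exactly \<open>d\<close> elements.\<close>

lemma expressive_class:
  fixes y y' :: real
  assumes y: "y \<in> Y" "y' \<in> Y" "y \<noteq> y'" and d: "2 ^ m \<le> d" "d \<le> 2 ^ Suc m"
  obtains G x where "G \<subseteq> prediction_functions MX Y" "finite G" "card G = d"
    "\<And>g i. g \<in> G \<Longrightarrow> i \<le> m \<Longrightarrow> g (x i) \<in> {y, y'}"
    "\<And>\<sigma>. \<sigma> \<subseteq> {..<m} \<Longrightarrow> \<exists>g\<in>G. \<forall>i<m. g (x i) = y \<longleftrightarrow> i \<in> \<sigma>"
proof -
  have "UNIV \<in> sets MX" using sets.top[of MX] by (simp add: space_MX)
  moreover have "infinite {C \<in> sets MX. C \<subseteq> UNIV}" using infinite_sets_MX by simp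
  ultimately have "\<exists>A :: nat \<Rightarrow> 'x set. (\<forall>i<Suc m. A i \<in> sets MX \<and> A i \<noteq> {} \<and> A i \<subseteq> UNIV) \<and>
    (\<forall>i<Suc m. \<forall>j<Suc m. i \<noteq> j \<longrightarrow> A i \<inter> A j = {})"
    by (rule infinite_sigma_algebra_disjoint_sets)
  then obtain A :: "nat \<Rightarrow> 'x set"
    where A_all: "\<forall>i<Suc m. A i \<in> sets MX \<and> A i \<noteq> {} \<and> A i \<subseteq> UNIV"
      "\<forall>i<Suc m. \<forall>j<Suc m. i \<noteq> j \<longrightarrow> A i \<inter> A j = {}"
    by (elim exE conjE)
  have A: "A i \<in> sets MX" "A i \<noteq> {}" if "i < Suc m" for i using A_all(1) that by auto
  have A_disj: "A i \<inter> A j = {}" if "i < Suc m" "j < Suc m" "i \<noteq> j" for i j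
    using A_all(2) that by auto
  define x where "x i = (SOME x. x \<in> A i)" for i
  have x: "x i \<in> A i" if "i < Suc m" for i
    unfolding x_def using A(2)[OF that] by (simp add: some_in_eq)
  define g where "g \<tau> t = (if t \<in> (\<Union>i\<in>\<tau>. A i) then y else y')" for \<tau> :: "nat set" and t
  have g_x: "g \<tau> (x i) = y \<longleftrightarrow> i \<in> \<tau>" if "\<tau> \<subseteq> {..<Suc m}" "i < Suc m" for \<tau> i
  proof -
    have "x i \<in> A j \<longleftrightarrow> i = j" if "j \<in> \<tau>" for j
      using A_disj[of i j] x[of i] that \<open>\<tau> \<subseteq> {..<Suc m}\<close> \<open>i < Suc m\<close> by auto
    then show ?thesis using y by (auto simp: g_def)
  qed
  have inj: "inj_on g (Pow {..<Suc m})"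
  proof (rule inj_onI)
    fix \<tau> \<tau>' assume t: "\<tau> \<in> Pow {..<Suc m}" "\<tau>' \<in> Pow {..<Suc m}" and eq: "g \<tau> = g \<tau>'"
    have "i \<in> \<tau> \<longleftrightarrow> i \<in> \<tau>'" if "i < Suc m" for i
      using g_x[of \<tau> i] g_x[of \<tau>' i] t eq that by auto
    then show "\<tau> = \<tau>'" using t by blast
  qed
  have "\<exists>T. Pow {..<m} \<subseteq> T \<and> T \<subseteq> Pow {..<Suc m} \<and> card T = d"
    using d by (intro exists_subset_between) (auto simp: card_Pow)
  then obtain T where T: "Pow {..<m} \<subseteq> T" "T \<subseteq> Pow {..<Suc m}" "card T = d" by blast
  show thesis
  proof (rule that[of "g ` T" x])
    show "g ` T \<subseteq> prediction_functions MX Y"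
    proof safe
      fix \<tau> assume "\<tau> \<in> T"
      then have "\<tau> \<subseteq> {..<Suc m}" using T by auto
      then have "(\<Union>i\<in>\<tau>. A i) \<in> sets MX"
        using A(1) finite_subset by (intro sets.finite_UN) auto
      then have "g \<tau> \<in> borel_measurable MX"
        unfolding g_def by (intro measurable_If_set) (auto simp: space_MX)
      then show "g \<tau> \<in> prediction_functions MX Y"
        unfolding output_space_def using y by (intro measurable_restrict_space2) (auto simp: g_def)
    qed
    show "finite (g ` T)" using T(2) finite_subset by auto
    show "card (g ` T) = d" using card_image[OF inj_on_subset[OF inj T(2)]] T(3) by simp
    show "f (x i) \<in> {y, y'}" if "f \<in> g ` T" for f i using that by (auto simp: g_def)
    show "\<exists>f\<in>g ` T. \<forall>i<m. f (x i) = y \<longleftrightarrow> i \<in> \<sigma>" if "\<sigma> \<subseteq> {..<m}" for \<sigma>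
    proof
      show "g \<sigma> \<in> g ` T" using that T by auto
      show "\<forall>i<m. g \<sigma> (x i) = y \<longleftrightarrow> i \<in> \<sigma>"
      proof (intro allI impI)
        fix i assume "i < m"
        moreover have "\<sigma> \<subseteq> {..<Suc m}" using that by (rule order_trans) auto
        ultimately show "g \<sigma> (x i) = y \<longleftrightarrow> i \<in> \<sigma>" using g_x[of \<sigma> i] by simp
      qed
    qed
  qed
qed

end

subsection \<open>The lower bound\<close>

context main_assumptions
begin

lemma lower_bound_finite_class:
  assumes y1: "y1 \<in> Y" "y1 > a" and yt1: "yt1 \<in> Y" "yt1 > a" and d: "d \<ge> 1"
  defines "\<delta> \<equiv> l y1 (2 * a - yt1) - l y1 yt1"
  shows "\<delta> > 0 \<and> (\<exists>G. G \<subseteq> prediction_functions MX Y \<and> finite G \<and> card G = d \<and>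
    (\<forall>n alg. n \<ge> 1 \<longrightarrow> learning_algorithm MX Y n alg \<longrightarrow>
      (\<forall>z \<in> space (training_space n (data_space MX Y)). alg z \<in> G) \<longrightarrow>
      (\<exists>P. data_distribution MX Y P \<and>
        measure P {z \<in> space P. snd z \<in> {2 * a - y1, y1}} = 1 \<and>
        risks_exist l n P G alg \<and>
        expected_risk l n P alg \<ge> (MIN g\<in>G. risk l P g) +
          \<delta> / 8 * ereal (min (sqrt (real_of_int \<lfloor>log 2 (real (card G))\<rfloor> / real n)) 2))))"
proof -
  have refl: "2 * a - yt1 \<in> Y" "yt1 \<noteq> 2 * a - yt1" using yt1 symmetric_Y by auto
  have lt: "l y1 yt1 < l y1 (2 * a - yt1)"
    using admissible y1 yt1 by (auto simp: admissible_loss_def)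
  \<comment> \<open>Being strictly below another value, the loss on the right side of
    \<open>a\<close> is finite even if \<open>\<delta>\<close> is not.\<close>
  then obtain u where u: "l y1 yt1 = ereal u"
    using loss_not_minf[OF y1(1) yt1(1)] by (cases "l y1 yt1") auto
  have pos: "\<delta> > 0" unfolding \<delta>_def using lt u by (cases "l y1 (2 * a - yt1)") auto
  define m where "m = nat \<lfloor>log 2 (real d)\<rfloor>"
  have log_nonneg: "log 2 (real d) \<ge> 0" using d by simp
  then have m: "\<lfloor>log 2 (real d)\<rfloor> = int m" by (simp add: m_def)
  have "2 ^ m \<le> d \<and> d < 2 ^ (m + 1)"
    using floor_log_nat_eq_powr_iff[of 2 d m] m d by auto
  then have md: "2 ^ m \<le> d" "d \<le> 2 ^ Suc m" by auto
  obtain G x where G: "G \<subseteq> prediction_functions MX Y" "finite G" "card G = d"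
    and Gx: "\<And>g i. g \<in> G \<Longrightarrow> i \<le> m \<Longrightarrow> g (x i) \<in> {yt1, 2 * a - yt1}"
    and full: "\<And>\<sigma>. \<sigma> \<subseteq> {..<m} \<Longrightarrow> \<exists>g\<in>G. \<forall>i<m. g (x i) = yt1 \<longleftrightarrow> i \<in> \<sigma>"
    by (rule expressive_class[OF yt1(1) refl md]) blast
  have "G \<noteq> {}" using G d by auto
  show ?thesis
  proof (intro conjI pos exI[of _ G] G allI impI)
    fix n :: nat and alg
    assume n: "n \<ge> 1" and alg: "learning_algorithm MX Y n alg"
      and algG: "\<forall>z \<in> space (training_space n (data_space MX Y)). alg z \<in> G"
    have card_log: "real_of_int \<lfloor>log 2 (real (card G))\<rfloor> = real m" using G m by simp
    show "\<exists>P. data_distribution MX Y P \<and>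
        measure P {z \<in> space P. snd z \<in> {2 * a - y1, y1}} = 1 \<and>
        risks_exist l n P G alg \<and>
        expected_risk l n P alg \<ge> (MIN g\<in>G. risk l P g) +
          \<delta> / 8 * ereal (min (sqrt (real_of_int \<lfloor>log 2 (real (card G))\<rfloor> / real n)) 2)"
    proof (cases "l y1 (2 * a - yt1) = \<infinity>")
      case True
      show ?thesis
        using exists_infinite_risk_distribution[OF y1(1) yt1(1) True G(2) \<open>G \<noteq> {}\<close> G(1) Gx[OF _ le0] alg]
          algG by force
    next
      case False
      then obtain v where v: "l y1 (2 * a - yt1) = ereal v"
        using loss_not_minf[OF y1(1) refl(1)] by (cases "l y1 (2 * a - yt1)") auto
      \<comment> \<open>Halving yields both \<open>\<xi> \<le> 1\<close> and
        \<open>n * \<xi>^2 \<le> m / 4\<close>, and turns the target \<open>\<delta> / 8\<close>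
        times the minimum into \<open>\<delta> * \<xi> / 4\<close>.\<close>
      define \<xi> where "\<xi> = min (sqrt (real m / real n)) 2 / 2"
      \<comment> \<open>For \<open>m = 0\<close> one point is still needed to carry the inputs; then
        \<open>\<xi> = 0\<close>.\<close>
      define k where "k = max 1 m"
      have \<xi>: "0 \<le> \<xi>" "\<xi> \<le> 1" by (auto simp: \<xi>_def)
      have "\<xi>\<^sup>2 \<le> (sqrt (real m / real n) / 2)\<^sup>2"
        using \<xi>(1) by (intro power_mono) (auto simp: \<xi>_def)
      also have "\<dots> = real m / real n / 4" by (simp add: power_divide)
      finally have "real n * \<xi>\<^sup>2 \<le> real m / 4" using n by (simp add: field_simps)
      then have n_\<xi>: "real n * \<xi>\<^sup>2 \<le> real k / 4" by (auto simp: k_def)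
      have k_m: "k = m" if "\<xi> \<noteq> 0" using that by (cases m) (auto simp: \<xi>_def k_def)
      have "\<exists>P. data_distribution MX Y P \<and>
          measure P {z \<in> space P. snd z \<in> {2 * a - y1, y1}} = 1 \<and>
          risks_exist l n P G alg \<and>
          expected_risk l n P alg \<ge> (MIN g\<in>G. risk l P g) + ereal ((v - u) * \<xi> / 4)"
      proof (rule exists_hard_distribution[where x = x and k = k and u = u and ?yt1.0 = yt1])
        show "l y1 (2 * a - yt1) = ereal (u + (v - u))" using v by simp
        show "v - u > 0" using lt u v by simp
        show "g (x i) \<in> {yt1, 2 * a - yt1}" if "g \<in> G" "i < k" for g i
          using that by (intro Gx) (auto simp: k_def)
        show "\<exists>g\<in>G. \<forall>i<k. g (x i) = yt1 \<longleftrightarrow> i \<in> \<sigma>" if "\<sigma> \<subseteq> {..<k}" "\<xi> \<noteq> 0" for \<sigma>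
          using full that k_m by auto
      qed (use y1 yt1 u G \<open>G \<noteq> {}\<close> \<xi> n_\<xi> alg algG in \<open>auto simp: k_def\<close>)
      moreover have "\<delta> / 8 * ereal (min (sqrt (real_of_int \<lfloor>log 2 (real (card G))\<rfloor> / real n)) 2)
          = ereal ((v - u) * \<xi> / 4)"
        unfolding card_log \<delta>_def u v by (simp add: \<xi>_def del: ereal_min)
      ultimately show ?thesis by simp
    qed
  qed
qed

end

theorem theorem2:
  fixes MX :: "'x measure" and Y :: "real set" and a :: real
    and l :: "real \<Rightarrow> real \<Rightarrow> ereal"
  assumes "main_assumptions MX Y a l"
  shows
    "(loss_gap Y l < \<infinity> \<longrightarrow>
       (\<forall>G n P alg. finite G \<longrightarrow> G \<noteq> {} \<longrightarrow> G \<subseteq> prediction_functions MX Y \<longrightarrow> n \<ge> 1 \<longrightarrow>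
          data_distribution MX Y P \<longrightarrow> empirical_risk_minimizer MX Y l G n alg \<longrightarrow>
          expected_risk l n P alg \<le>
            (MIN g\<in>G. risk l P g) + loss_gap Y l * ereal (sqrt (2 * ln (real (card G)) / real n))))
     \<and>
     (\<forall>y1 \<in> Y \<inter> {a<..}. \<forall>yt1 \<in> Y \<inter> {a<..}. \<forall>d::nat. d \<ge> 1 \<longrightarrow>
       (let \<delta> = l y1 (2 * a - yt1) - l y1 yt1 in
        \<delta> > 0 \<and>
        (\<exists>G. G \<subseteq> prediction_functions MX Y \<and> finite G \<and> card G = d \<and>
          (\<forall>n alg. n \<ge> 1 \<longrightarrow> learning_algorithm MX Y n alg \<longrightarrow>
            (\<forall>z \<in> space (training_space n (data_space MX Y)). alg z \<in> G) \<longrightarrow>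
            (\<exists>P. data_distribution MX Y P \<and>
              measure P {z \<in> space P. snd z \<in> {2 * a - y1, y1}} = 1 \<and>
              risks_exist l n P G alg \<and>
              expected_risk l n P alg \<ge>
                (MIN g\<in>G. risk l P g) +
                \<delta> / 8 * ereal (min (sqrt (real_of_int \<lfloor>log 2 (real (card G))\<rfloor> / real n)) 2))))))"
proof -
  interpret main_assumptions MX Y a l by fact
  show ?thesis
  proof (rule conjI)
    show "loss_gap Y l < \<infinity> \<longrightarrow>
       (\<forall>G n P alg. finite G \<longrightarrow> G \<noteq> {} \<longrightarrow> G \<subseteq> prediction_functions MX Y \<longrightarrow> n \<ge> 1 \<longrightarrow>
          data_distribution MX Y P \<longrightarrow> empirical_risk_minimizer MX Y l G n alg \<longrightarrow>
          expected_risk l n P alg \<le>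
            (MIN g\<in>G. risk l P g) + loss_gap Y l * ereal (sqrt (2 * ln (real (card G)) / real n)))"
      by (intro impI allI expected_risk_erm_le)
  qed (unfold Let_def, intro ballI allI impI, rule lower_bound_finite_class, simp_all)
qed

end
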